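(* Let $\Gamma\vdash M:A$ be derivable in $\lambda$A. If $A$ is positively finite and $\Gamma(x)$ is negatively finite for every $x\in\mathrm{Dom}(\Gamma)$, then $M$ is maximal, i.e. the Böhm tree of $M$ contains no occurrence of $\bot$ (every node of the Böhm tree is head normalizable).
   Context: Type expressions: fix a countably infinite set of type variables $X,Y,Z,\dots$. Pseudo type expressions are generated by $A::=X\mid A\to A\mid \bullet A\mid \mu X.A$ ($\mu$ binds $X$; $\alpha$-convertible expressions are identified; $\to$ associates to the right; $\bullet$ binds tighter than $\to$, which binds tighter than $\mu$). $A[B/X]$ denotes capture-avoiding substitution. $\top$ abbreviates $\mu X.\bullet X$, and $\bullet^n A$ denotes $A$ prefixed by $n$ copies of $\bullet$. The tail $t(A)$ is defined by $t(X)=X$, $t(A\to B)=t(B)$, $t(\bullet A)=\bullet t(A)$, $t(\mu X.A)=\mu X.t(A)$; it always has the form $\bullet^{m_0}\mu X_1.\bullet^{m_1}\mu X_2.\cdots\mu X_n.\bullet^{m_n}Y$. $A$ is a $\top$-variant iff $Y=X_i$ for some $1\le i\le n$ with $X_i\notin\{X_{i+1},\dots,X_n\}$ and $m_i+\dots+m_n\ge 1$. $A$ is proper in $X$ iff: a variable $Y$ is proper in $X$ iff $Y\neq X$; $\bullet A$ is always proper in $X$; $A\to B$ is proper in $X$ iff both $A,B$ are proper in $X$ or $B$ is a $\top$-variant; for $Y\ne X$, $\mu Y.A$ is proper in $X$ iff $A$ is proper in $X$ or $\mu Y.A$ is a $\top$-variant. Type expressions are the least set of pseudo type expressions containing all type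 variables, closed under $\to$ and $\bullet$, and containing $\mu X.A$ whenever it contains $A$ and $A$ is proper in $X$. Equality: $\cong$ is the least relation on type expressions such that: $A\cong A$; $A\cong B$ implies $B\cong A$; $A\cong B$ and $B\cong C$ imply $A\cong C$; $A\cong B$ implies $\bullet A\cong\bullet B$; $A\cong C$ and $B\cong D$ imply $A\to B\cong C\to D$; $A\to\top\cong\top$; $\mu X.A\cong A[\mu X.A/X]$; and if $A\cong C[A/X]$ with $C$ proper in $X$, then $A\cong\mu X.C$. $\simeq$ is the least relation satisfying the same closure conditions and additionally $\bullet(A\to B)\simeq\bullet A\to\bullet B$. Subtyping: a subtyping assumption $\gamma$ is a finite set of pairs $X\preceq Y$ of type variables in which each type variable occurs at most once; $FTV(\gamma)$ is the set of variables occurring in it. Judgments $\gamma\vdash A\preceq B$ are derived by the rules: $\gamma\cup\{X\preceq Y\}\vdash X\preceq Y$; $\gamma\vdash A\preceq\top$; from $A\simeq B$ infer $\gamma\vdash A\preceq B$; from $\gamma_1\vdash A\preceq B$ and $\gamma_2\vdash B\preceq C$ infer $\gamma_1\cup\gamma_2\vdash A\preceq C$; from $\gamma\vdash A\preceq B$ infer $\gamma\vdash\bullet A\preceq\bullet B$; from $\gamma_1\vdash A'\preceq A$ and $\gamma_2\vdash B\preceq B'$ infer $\gamma_1\cup\gamma_2\vdash A\to B\preceq A'\to B'$; from $\gamma\cup\{X\preceq Y\}\vdash A\preceq B$ infer $\gamma\vdash\mu X.A\preceq\mu Y.B$, provided $X\notin FTV(\gamma)\cup FTV(B)$, $Y\notin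 FTV(\gamma)\cup FTV(A)$, $A$ is proper in $X$ and $B$ is proper in $Y$; and $\gamma\vdash A\preceq\bullet A$. All sets $\gamma\cup\{X\preceq Y\}$, $\gamma_1\cup\gamma_2$ must be well-formed subtyping assumptions. $A\preceq B$ means $\{\}\vdash A\preceq B$ is derivable. Typing system $\lambda$A: untyped $\lambda$-terms $M::=x\mid\lambda x.M\mid MM$ (identified up to $\alpha$-conversion). A typing context $\Gamma$ is a finite map from individual variables to type expressions, written $\{x_1:A_1,\dots,x_n:A_n\}$; $\bullet\Gamma$ is $\{x_1:\bullet A_1,\dots,x_n:\bullet A_n\}$; unions of contexts must be well-formed (a variable receives at most one type). Rules: (var) $\Gamma\cup\{x:A\}\vdash x:A$; (shift) from $\bullet\Gamma\vdash M:\bullet A$ infer $\Gamma\vdash M:A$; ($\top$) $\Gamma\vdash M:\top$; ($\preceq$) from $\Gamma\vdash M:A$ and $A\preceq B$ infer $\Gamma\vdash M:B$; ($\to$I) from $\Gamma\cup\{x:A\}\vdash M:B$ infer $\Gamma\vdash\lambda x.M:A\to B$; ($\to$E) from $\Gamma_1\vdash M:A\to B$ and $\Gamma_2\vdash N:A$ infer $\Gamma_1\cup\Gamma_2\vdash MN:B$. Effective positive/negative variables: $ETV^+(A)=ETV^-(A)=\emptyset$ if $A$ is a $\top$-variant; otherwise $ETV^+(X)=\{X\}$, $ETV^-(X)=\emptyset$; $ETV^\pm(\bullet A)=ETV^\pm(A)$; $ETV^\pm(A\to B)=ETV^\mp(A)\cup ETV^\pm(B)$; $ETV^\pm(\mu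 X.A)=(ETV^+(A)\cup ETV^-(A))\setminus\{X\}$ if $X\in ETV^-(A)$, and $ETV^\pm(\mu X.A)=ETV^\pm(A)\setminus\{X\}$ otherwise. A type expression $A$ is positively finite iff for all type expressions $B,C$ and type variables $X$ with $A\cong B[C/X]$, $X\in ETV^+(B)$ and $X\notin ETV^-(B)$, the type $C$ is not a $\top$-variant; $A$ is negatively finite iff for all $B,C,X$ with $A\cong B[C/X]$, $X\in ETV^-(B)$ and $X\notin ETV^+(B)$, the type $C$ is not a $\top$-variant. Böhm trees are the standard ones, with $\bot$ labelling subterms having no head normal form (head normal form: $\lambda x_1\cdots\lambda x_m.\,y\,N_1\cdots N_n$). *)

theory Defs
  imports Main
begin

text \<open>Free type variables are names (nat); variables bound by mu are de Bruijn
indices. This identifies alpha-convertible expressions. A pseudo type expression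
mu X. A is represented as Mu (closeT 0 X A).\<close>

datatype ty = TFVar nat | TBVar nat | Arr ty ty | Later ty | Mu ty

fun openT :: "nat \<Rightarrow> ty \<Rightarrow> ty \<Rightarrow> ty" where
  "openT k C (TFVar x) = TFVar x"
| "openT k C (TBVar i) = (if i = k then C else TBVar i)"
| "openT k C (Arr A B) = Arr (openT k C A) (openT k C B)"
| "openT k C (Later A) = Later (openT k C A)"
| "openT k C (Mu A) = Mu (openT (Suc k) C A)"

fun closeT :: "nat \<Rightarrow> nat \<Rightarrow> ty \<Rightarrow> ty" where
  "closeT k X (TFVar x) = (if x = X then TBVar k else TFVar x)"
| "closeT k X (TBVar i) = TBVar i"
| "closeT k X (Arr A B) = Arr (closeT k X A) (closeT k X B)"
| "closeT k X (Later A) = Later (closeT k X A)"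
| "closeT k X (Mu A) = Mu (closeT (Suc k) X A)"

text \<open>Substitution B[C/X] (capture avoiding, since C will be locally closed).\<close>
fun substT :: "nat \<Rightarrow> ty \<Rightarrow> ty \<Rightarrow> ty" where
  "substT X C (TFVar x) = (if x = X then C else TFVar x)"
| "substT X C (TBVar i) = TBVar i"
| "substT X C (Arr A B) = Arr (substT X C A) (substT X C B)"
| "substT X C (Later A) = Later (substT X C A)"
| "substT X C (Mu A) = Mu (substT X C A)"

fun fvT :: "ty \<Rightarrow> nat set" where
  "fvT (TFVar x) = {x}"
| "fvT (TBVar i) = {}"
| "fvT (Arr A B) = fvT A \<union> fvT B"
| "fvT (Later A) = fvT A"
| "fvT (Mu A) = fvT A"

definition Top :: ty where "Top = Mu (Later (TBVar 0))"

text \<open>Top-variants. The tail of A is computed implicitly: arrows are followed to the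
right. The list ctx records, for each enclosing mu of the tail (innermost first),
whether at least one bullet occurs between that binder and the current position.
A bound index not referring to a mu inside the expression counts as a free variable.\<close>
fun tvar :: "bool list \<Rightarrow> ty \<Rightarrow> bool" where
  "tvar ctx (TFVar x) = False"
| "tvar ctx (TBVar k) = (k < length ctx \<and> ctx ! k)"
| "tvar ctx (Arr A B) = tvar ctx B"
| "tvar ctx (Later A) = tvar (map (\<lambda>_. True) ctx) A"
| "tvar ctx (Mu A) = tvar (False # ctx) A"

definition top_variant :: "ty \<Rightarrow> bool" where
  "top_variant A = tvar [] A"

fun proper :: "nat \<Rightarrow> ty \<Rightarrow> bool" where
  "proper X (TFVar Y) = (Y \<noteq> X)"
| "proper X (TBVar i) = True"
| "proper X (Later A) = True"
| "proper X (Arr A B) = ((proper X A \<and> proper X B) \<or> top_variant B)"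
| "proper X (Mu A) = (proper X A \<or> top_variant (Mu A))"

inductive wfty :: "ty \<Rightarrow> bool" where
  wf_var: "wfty (TFVar X)"
| wf_arr: "wfty A \<Longrightarrow> wfty B \<Longrightarrow> wfty (Arr A B)"
| wf_later: "wfty A \<Longrightarrow> wfty (Later A)"
| wf_mu: "wfty A \<Longrightarrow> proper X A \<Longrightarrow> wfty (Mu (closeT 0 X A))"

inductive ty_eq :: "bool \<Rightarrow> ty \<Rightarrow> ty \<Rightarrow> bool" for d :: bool where
  eq_refl: "wfty A \<Longrightarrow> ty_eq d A A"
| eq_sym: "ty_eq d A B \<Longrightarrow> ty_eq d B A"
| eq_trans: "ty_eq d A B \<Longrightarrow> ty_eq d B C \<Longrightarrow> ty_eq d A C"
| eq_later: "ty_eq d A B \<Longrightarrow> ty_eq d (Later A) (Later B)"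
| eq_arr: "ty_eq d A C \<Longrightarrow> ty_eq d B D \<Longrightarrow> ty_eq d (Arr A B) (Arr C D)"
| eq_top: "wfty A \<Longrightarrow> ty_eq d (Arr A Top) Top"
| eq_unfold: "wfty (Mu A) \<Longrightarrow> ty_eq d (Mu A) (openT 0 (Mu A) A)"
| eq_contr: "wfty A \<Longrightarrow> wfty C \<Longrightarrow> proper X C \<Longrightarrow> ty_eq d A (substT X A C)
      \<Longrightarrow> ty_eq d A (Mu (closeT 0 X C))"
| eq_dist: "d \<Longrightarrow> wfty A \<Longrightarrow> wfty B \<Longrightarrow> ty_eq d (Later (Arr A B)) (Arr (Later A) (Later B))"

abbreviation ty_cong :: "ty \<Rightarrow> ty \<Rightarrow> bool" where "ty_cong \<equiv> ty_eq False"
abbreviation ty_sim :: "ty \<Rightarrow> ty \<Rightarrow> bool" where "ty_sim \<equiv> ty_eq True"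

definition wf_assum :: "(nat \<times> nat) set \<Rightarrow> bool" where
  "wf_assum \<gamma> \<longleftrightarrow> finite \<gamma> \<and> (\<forall>(a, b) \<in> \<gamma>. a \<noteq> b) \<and>
     (\<forall>p \<in> \<gamma>. \<forall>q \<in> \<gamma>. p \<noteq> q \<longrightarrow> {fst p, snd p} \<inter> {fst q, snd q} = {})"

definition ftv_assum :: "(nat \<times> nat) set \<Rightarrow> nat set" where
  "ftv_assum \<gamma> = fst ` \<gamma> \<union> snd ` \<gamma>"

inductive sub :: "(nat \<times> nat) set \<Rightarrow> ty \<Rightarrow> ty \<Rightarrow> bool" where
  sub_assm: "wf_assum (insert (X, Y) \<gamma>) \<Longrightarrow> sub (insert (X, Y) \<gamma>) (TFVar X) (TFVar Y)"
| sub_top: "wf_assum \<gamma> \<Longrightarrow> wfty A \<Longrightarrow> sub \<gamma> A Top"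
| sub_eq: "wf_assum \<gamma> \<Longrightarrow> ty_sim A B \<Longrightarrow> sub \<gamma> A B"
| sub_trans: "sub \<gamma>1 A B \<Longrightarrow> sub \<gamma>2 B C \<Longrightarrow> wf_assum (\<gamma>1 \<union> \<gamma>2) \<Longrightarrow> sub (\<gamma>1 \<union> \<gamma>2) A C"
| sub_later: "sub \<gamma> A B \<Longrightarrow> sub \<gamma> (Later A) (Later B)"
| sub_arr: "sub \<gamma>1 A' A \<Longrightarrow> sub \<gamma>2 B B' \<Longrightarrow> wf_assum (\<gamma>1 \<union> \<gamma>2)
      \<Longrightarrow> sub (\<gamma>1 \<union> \<gamma>2) (Arr A B) (Arr A' B')"
| sub_mu: "sub (insert (X, Y) \<gamma>) A B \<Longrightarrow> wf_assum (insert (X, Y) \<gamma>)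
      \<Longrightarrow> X \<notin> ftv_assum \<gamma> \<union> fvT B \<Longrightarrow> Y \<notin> ftv_assum \<gamma> \<union> fvT A
      \<Longrightarrow> proper X A \<Longrightarrow> proper Y B
      \<Longrightarrow> sub \<gamma> (Mu (closeT 0 X A)) (Mu (closeT 0 Y B))"
| sub_shift: "wf_assum \<gamma> \<Longrightarrow> wfty A \<Longrightarrow> sub \<gamma> A (Later A)"

definition subtype :: "ty \<Rightarrow> ty \<Rightarrow> bool" where
  "subtype A B \<longleftrightarrow> sub {} A B"

datatype lterm = Var nat | BVar nat | Lam lterm | App lterm lterm

fun openL :: "nat \<Rightarrow> lterm \<Rightarrow> lterm \<Rightarrow> lterm" where
  "openL k N (Var x) = Var x"
| "openL k N (BVar i) = (if i = k then N else BVar i)"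
| "openL k N (Lam M) = Lam (openL (Suc k) N M)"
| "openL k N (App M P) = App (openL k N M) (openL k N P)"

fun closeL :: "nat \<Rightarrow> nat \<Rightarrow> lterm \<Rightarrow> lterm" where
  "closeL k x (Var y) = (if y = x then BVar k else Var y)"
| "closeL k x (BVar i) = BVar i"
| "closeL k x (Lam M) = Lam (closeL (Suc k) x M)"
| "closeL k x (App M P) = App (closeL k x M) (closeL k x P)"

fun lc_at :: "nat \<Rightarrow> lterm \<Rightarrow> bool" where
  "lc_at k (Var x) = True"
| "lc_at k (BVar i) = (i < k)"
| "lc_at k (Lam M) = lc_at (Suc k) M"
| "lc_at k (App M P) = (lc_at k M \<and> lc_at k P)"

abbreviation lc :: "lterm \<Rightarrow> bool" where "lc \<equiv> lc_at 0"

type_synonym ctx = "nat \<rightharpoonup> ty"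

definition ctx_ok :: "ctx \<Rightarrow> bool" where
  "ctx_ok \<Gamma> \<longleftrightarrow> finite (dom \<Gamma>) \<and> (\<forall>A \<in> ran \<Gamma>. wfty A)"

definition later_ctx :: "ctx \<Rightarrow> ctx" where
  "later_ctx \<Gamma> = (\<lambda>x. map_option Later (\<Gamma> x))"

definition compatible :: "ctx \<Rightarrow> ctx \<Rightarrow> bool" where
  "compatible \<Gamma>1 \<Gamma>2 \<longleftrightarrow> (\<forall>x \<in> dom \<Gamma>1 \<inter> dom \<Gamma>2. \<Gamma>1 x = \<Gamma>2 x)"

inductive typing :: "ctx \<Rightarrow> lterm \<Rightarrow> ty \<Rightarrow> bool" where
  t_var: "ctx_ok \<Gamma> \<Longrightarrow> \<Gamma> x = Some A \<Longrightarrow> typing \<Gamma> (Var x) A"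
| t_shift: "typing (later_ctx \<Gamma>) M (Later A) \<Longrightarrow> typing \<Gamma> M A"
| t_top: "ctx_ok \<Gamma> \<Longrightarrow> lc M \<Longrightarrow> typing \<Gamma> M Top"
| t_sub: "typing \<Gamma> M A \<Longrightarrow> subtype A B \<Longrightarrow> typing \<Gamma> M B"
| t_abs: "typing (\<Gamma>(x \<mapsto> A)) M B \<Longrightarrow> \<Gamma> x = None \<or> \<Gamma> x = Some A
      \<Longrightarrow> typing \<Gamma> (Lam (closeL 0 x M)) (Arr A B)"
| t_app: "typing \<Gamma>1 M (Arr A B) \<Longrightarrow> typing \<Gamma>2 N A \<Longrightarrow> compatible \<Gamma>1 \<Gamma>2
      \<Longrightarrow> typing (\<Gamma>1 ++ \<Gamma>2) (App M N) B"

datatype tatom = AF nat | AB nat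

definition unb :: "tatom set \<Rightarrow> tatom set" where
  "unb S = {AF x | x. AF x \<in> S} \<union> {AB k | k. AB (Suc k) \<in> S}"

fun etv :: "ty \<Rightarrow> tatom set \<times> tatom set" where
  "etv (TFVar x) = (if top_variant (TFVar x) then ({}, {}) else ({AF x}, {}))"
| "etv (TBVar k) = (if top_variant (TBVar k) then ({}, {}) else ({AB k}, {}))"
| "etv (Later A) = (if top_variant (Later A) then ({}, {}) else etv A)"
| "etv (Arr A B) = (if top_variant (Arr A B) then ({}, {}) else
      (snd (etv A) \<union> fst (etv B), fst (etv A) \<union> snd (etv B)))"
| "etv (Mu A) = (if top_variant (Mu A) then ({}, {}) else
      (if AB 0 \<in> snd (etv A)
       then (unb (fst (etv A) \<union> snd (etv A)), unb (fst (etv A) \<union> snd (etv A)))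
       else (unb (fst (etv A)), unb (snd (etv A)))))"

definition ETVp :: "ty \<Rightarrow> nat set" where "ETVp A = {x. AF x \<in> fst (etv A)}"
definition ETVn :: "ty \<Rightarrow> nat set" where "ETVn A = {x. AF x \<in> snd (etv A)}"

definition pos_finite :: "ty \<Rightarrow> bool" where
  "pos_finite A \<longleftrightarrow> (\<forall>B C X. wfty B \<and> wfty C \<and> ty_cong A (substT X C B)
     \<and> X \<in> ETVp B \<and> X \<notin> ETVn B \<longrightarrow> \<not> top_variant C)"

definition neg_finite :: "ty \<Rightarrow> bool" where
  "neg_finite A \<longleftrightarrow> (\<forall>B C X. wfty B \<and> wfty C \<and> ty_cong A (substT X C B)
     \<and> X \<in> ETVn B \<and> X \<notin> ETVp B \<longrightarrow> \<not> top_variant C)"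

inductive beta :: "lterm \<Rightarrow> lterm \<Rightarrow> bool" where
  b_beta: "lc (Lam M) \<Longrightarrow> lc N \<Longrightarrow> beta (App (Lam M) N) (openL 0 N M)"
| b_appL: "beta M M' \<Longrightarrow> lc N \<Longrightarrow> beta (App M N) (App M' N)"
| b_appR: "beta N N' \<Longrightarrow> lc M \<Longrightarrow> beta (App M N) (App M N')"
| b_lam: "beta M M' \<Longrightarrow> beta (Lam (closeL 0 x M)) (Lam (closeL 0 x M'))"

fun lams :: "nat list \<Rightarrow> lterm \<Rightarrow> lterm" where
  "lams [] P = P"
| "lams (x # xs) P = Lam (closeL 0 x (lams xs P))"

definition apps :: "lterm \<Rightarrow> lterm list \<Rightarrow> lterm" where
  "apps h Ns = foldl App h Ns"

text \<open>M is maximal iff its Boehm tree contains no bottom: M has a head normal form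
\<open>\<lambda>x1...xm. y N1 ... Nn\<close> and (coinductively) every Ni is maximal.\<close>
coinductive maximal :: "lterm \<Rightarrow> bool" where
  "beta\<^sup>*\<^sup>* M (lams xs (apps (Var y) Ns)) \<Longrightarrow> (\<forall>N \<in> set Ns. lc N \<and> maximal N) \<Longrightarrow> maximal M"

end

theory Submission
  imports Defs "HOL-Library.Product_Lexorder"
begin

text \<open>The proof is a realizability argument indexed by the ordinal \<open>\<omega>\<^sup>2\<close>, written as pairs
  \<open>(k, j)\<close> ordered lexicographically. A type denotes a decreasing family of sets of terms, the
  modality refers to all strictly smaller worlds, and properness makes recursive types well-founded
  fixed points. The next world of \<open>(k, j)\<close> being \<open>(k, j + 1)\<close>, finitely many modalities are absorbed
  within the level \<open>k\<close>, so a type whose tail is a variable still forces a head normal form there.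
  By induction on \<open>k\<close> one shows simultaneously that neutral terms whose arguments have Boehm trees
  without bottom up to depth \<open>k\<close> inhabit all negatively finite types at \<open>(k, j)\<close>, and that
  inhabitants of positively finite types at \<open>(k, j)\<close> have Boehm trees without bottom up to depth
  \<open>k\<close>: passing from level \<open>k + 1\<close> to all the worlds of level \<open>k\<close> uncovers one more layer of the
  tree.\<close>

section \<open>Well-formed type expressions\<close>

fun lcT :: "nat \<Rightarrow> ty \<Rightarrow> bool" where
  "lcT k (TFVar x) = True"
| "lcT k (TBVar i) = (i < k)"
| "lcT k (Arr A B) = (lcT k A \<and> lcT k B)"
| "lcT k (Later A) = lcT k A"
| "lcT k (Mu A) = lcT (Suc k) A"

text \<open>Substitution for all free variables at once, so that renaming a bound variable can be
  absorbed into \<open>\<sigma>\<close> during inductions over \<open>wfty\<close>.\<close>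

fun msubst :: "(nat \<Rightarrow> ty) \<Rightarrow> ty \<Rightarrow> ty" where
  "msubst \<sigma> (TFVar x) = \<sigma> x"
| "msubst \<sigma> (TBVar i) = TBVar i"
| "msubst \<sigma> (Arr A B) = Arr (msubst \<sigma> A) (msubst \<sigma> B)"
| "msubst \<sigma> (Later A) = Later (msubst \<sigma> A)"
| "msubst \<sigma> (Mu A) = Mu (msubst \<sigma> A)"

lemma lcT_closeT: "lcT k A \<Longrightarrow> lcT (Suc k) (closeT k X A)"
  by (induction A arbitrary: k) auto

lemma wfty_lcT: "wfty A \<Longrightarrow> lcT 0 A"
  by (induction rule: wfty.induct) (auto simp: lcT_closeT)

lemma openT_closeT: "lcT k A \<Longrightarrow> openT k C (closeT k X A) = substT X C A"
  by (induction A arbitrary: k) auto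

lemma finite_fvT [simp]: "finite (fvT A)"
  by (induction A) auto

lemma ex_fresh: "finite S \<Longrightarrow> \<exists>x::nat. x \<notin> S"
  by (simp add: ex_new_if_finite)

lemma substT_eq_msubst: "substT X C A = msubst (TFVar(X := C)) A"
  by (induction A) auto

text \<open>A top-variant has a tail ending in a bound index, which substitution leaves alone. The
  converse fails when a top-variant is put at a free tail.\<close>

lemma tvar_msubst: "tvar ctx A \<Longrightarrow> tvar ctx (msubst \<sigma> A)"
  by (induction A arbitrary: ctx) auto

lemma proper_if_fresh: "X \<notin> fvT A \<Longrightarrow> proper X A"
  by (induction A) auto

lemma proper_msubst:
  "proper X A \<Longrightarrow> \<forall>x\<in>fvT A. x \<noteq> X \<longrightarrow> Y \<notin> fvT (\<sigma> x) \<Longrightarrow> proper Y (msubst \<sigma> A)"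
proof (induction A)
  case (TFVar x)
  then show ?case by (simp add: proper_if_fresh)
qed (auto simp: top_variant_def intro: tvar_msubst)

lemma closeT_fresh: "X \<notin> fvT A \<Longrightarrow> closeT k X A = A"
  by (induction A arbitrary: k) auto

lemma msubst_closeT:
  "\<forall>x\<in>fvT A. x \<noteq> X \<longrightarrow> Y \<notin> fvT (\<sigma> x) \<Longrightarrow>
    msubst \<sigma> (closeT k X A) = closeT k Y (msubst (\<sigma>(X := TFVar Y)) A)"
  by (induction A arbitrary: k) (auto simp: closeT_fresh)

lemma wfty_msubst: "wfty A \<Longrightarrow> \<forall>x. wfty (\<sigma> x) \<Longrightarrow> wfty (msubst \<sigma> A)"
proof (induction arbitrary: \<sigma> rule: wfty.induct)
  case (wf_mu A X)
  \<comment> \<open>A binder name that no substituted type mentions; the induction hypothesis is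
    then used with \<open>\<sigma>(X := TFVar Y)\<close>.\<close>
  obtain Y where Y: "Y \<notin> (\<Union>x\<in>fvT A. fvT (\<sigma> x))"
    using ex_fresh[of "\<Union>x\<in>fvT A. fvT (\<sigma> x)"] by auto
  have "wfty (msubst (\<sigma>(X := TFVar Y)) A)"
    using wf_mu by (simp add: wfty.wf_var)
  moreover have "proper Y (msubst (\<sigma>(X := TFVar Y)) A)"
    by (rule proper_msubst[OF wf_mu.hyps(2)]) (use Y in auto)
  moreover have "msubst \<sigma> (closeT 0 X A) = closeT 0 Y (msubst (\<sigma>(X := TFVar Y)) A)"
    by (rule msubst_closeT) (use Y in auto)
  ultimately show ?case by (simp add: wfty.wf_mu)
qed (auto intro: wfty.intros)

lemma wfty_substT: "wfty A \<Longrightarrow> wfty C \<Longrightarrow> wfty (substT X C A)"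
  by (auto simp: substT_eq_msubst intro!: wfty_msubst wfty.wf_var)

inductive_cases wfty_ArrE: "wfty (Arr A B)"
inductive_cases wfty_LaterE: "wfty (Later A)"
inductive_cases wfty_MuE: "wfty (Mu A)"

lemma wfty_unfold: "wfty (Mu A) \<Longrightarrow> wfty (openT 0 (Mu A) A)"
  by (metis openT_closeT ty.inject(5) wfty_MuE wfty_lcT wfty_substT)

lemma wfty_Top: "wfty Top"
proof -
  have "wfty (Mu (closeT 0 0 (Later (TFVar 0))))"
    by (intro wfty.intros) auto
  then show ?thesis by (simp add: Top_def)
qed

lemma ty_eq_wfty: "ty_eq d A B \<Longrightarrow> wfty A \<and> wfty B"
  by (induction rule: ty_eq.induct)
    (auto simp: wfty_Top wfty_unfold intro: wfty.intros)

lemma sub_wfty: "sub \<gamma> A B \<Longrightarrow> wfty A \<and> wfty B"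
  by (induction rule: sub.induct) (auto simp: wfty_Top dest: ty_eq_wfty intro: wfty.intros)

section \<open>Tails\<close>

fun tail_free :: "ty \<Rightarrow> bool" where
  "tail_free (TFVar x) = True"
| "tail_free (TBVar i) = False"
| "tail_free (Arr A B) = tail_free B"
| "tail_free (Later A) = tail_free A"
| "tail_free (Mu A) = tail_free A"

text \<open>The number of constructors on the path to the tail variable. It serves as termination
  measure for unfolding, which removes a \<open>Mu\<close> from this path and leaves the rest of it
  unchanged if the tail is free.\<close>

fun tail_length :: "ty \<Rightarrow> nat" where
  "tail_length (TFVar x) = 0"
| "tail_length (TBVar i) = 0"
| "tail_length (Arr A B) = Suc (tail_length B)"
| "tail_length (Later A) = Suc (tail_length A)"
| "tail_length (Mu A) = Suc (tail_length A)"

lemma tail_free_openT: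
  "tail_free A \<Longrightarrow> tail_free (openT k C A) \<and> tail_length (openT k C A) = tail_length A"
  by (induction A arbitrary: k) auto

lemma tail_free_not_tvar: "tail_free A \<Longrightarrow> \<not> tvar ctx A"
  by (induction A arbitrary: ctx) auto

lemma tvar_closeT: "tvar ctx A \<Longrightarrow> tvar (ctx @ ctx') (closeT k X A)"
proof (induction A arbitrary: ctx ctx' k)
  case (Mu A)
  then show ?case by (metis append_Cons closeT.simps(5) tvar.simps(5))
qed (auto simp: nth_append)

text \<open>If closing destroys the free tail, then the tail variable was \<open>X\<close>. Its new
  binder owns the last entry of the list, here one that has already passed a bullet.\<close>

lemma tvar_closeT_True:
  "tail_free A \<Longrightarrow> \<not> tail_free (closeT k X A) \<Longrightarrow> length ctx = k
    \<Longrightarrow> tvar (ctx @ [True]) (closeT k X A)"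
proof (induction A arbitrary: k ctx)
  case (Mu A)
  then show ?case using Mu.IH[of "Suc k" "False # ctx"] by simp
next
  case (Later A)
  then show ?case using Later.IH[of k "map (\<lambda>_. True) ctx"] by simp
qed (auto split: if_splits)

text \<open>The new binder starts with \<open>False\<close>; properness forces a bullet on the way
  to the tail, from where on \<open>tvar_closeT_True\<close> applies.\<close>

lemma tvar_closeT_proper:
  "tail_free A \<Longrightarrow> \<not> tail_free (closeT k X A) \<Longrightarrow> proper X A \<Longrightarrow> length ctx = k
    \<Longrightarrow> tvar (ctx @ [False]) (closeT k X A)"
proof (induction A arbitrary: k ctx)
  case (Mu A)
  then show ?case using Mu.IH[of "Suc k" "False # ctx"]
    by (auto simp: top_variant_def tail_free_not_tvar)
next
  case (Later A)
  then show ?case using tvar_closeT_True[of A k X "map (\<lambda>_. True) ctx"] by simp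
qed (auto simp: top_variant_def tail_free_not_tvar split: if_splits)

text \<open>Under a new \<open>Mu\<close> a bound tail arises in two ways: the tail variable has
  just been captured, and properness supplies the bullet, or the body was a top-variant
  before.\<close>

lemma top_variant_iff: "wfty A \<Longrightarrow> top_variant A \<longleftrightarrow> \<not> tail_free A"
proof (induction rule: wfty.induct)
  case (wf_mu A X)
  show ?case
  proof (cases "tail_free (closeT 0 X A)")
    case True
    then show ?thesis by (simp add: top_variant_def tail_free_not_tvar)
  next
    case False
    have "tvar [False] (closeT 0 X A)"
    proof (cases "tail_free A")
      case True
      then show ?thesis using tvar_closeT_proper[OF True False wf_mu.hyps(2), of "[]"] by simp
    next
      case False
      then show ?thesis using wf_mu.IH tvar_closeT[of "[]" A "[False]"] by (simp add: top_variant_def)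
    qed
    then show ?thesis using False by (simp add: top_variant_def)
  qed
qed (auto simp: top_variant_def)

text \<open>Induction along the tail in which a recursive type is reduced to its unfolding. Thus all
  types met are closed and well-formed, and no environment for bound indices is needed.\<close>

lemma tail_free_induct [consumes 2, case_names Var Arr Later Mu]:
  assumes "tail_free A" "wfty A"
    and var: "\<And>X. P (TFVar X)"
    and arr: "\<And>A B. tail_free B \<Longrightarrow> wfty A \<Longrightarrow> wfty B \<Longrightarrow> P B \<Longrightarrow> P (Arr A B)"
    and later: "\<And>A. wfty A \<Longrightarrow> P A \<Longrightarrow> P (Later A)"
    and mu: "\<And>A. wfty (Mu A) \<Longrightarrow> P (openT 0 (Mu A) A) \<Longrightarrow> P (Mu A)"
  shows "P A"
  using assms(1,2)
proof (induction "tail_length A" arbitrary: A rule: less_induct)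
  case less
  show ?case
  proof (cases A)
    case (TFVar x)
    then show ?thesis using var by simp
  next
    case (TBVar i)
    then show ?thesis using less.prems by simp
  next
    case (Arr B C)
    then show ?thesis using less by (auto intro!: arr elim: wfty_ArrE)
  next
    case (Later B)
    then show ?thesis using less by (auto intro!: later elim: wfty_LaterE)
  next
    case (Mu B)
    then have "P (openT 0 (Mu B) B)"
      using less tail_free_openT[of B 0 "Mu B"] wfty_unfold[of B] by simp
    then show ?thesis using Mu less.prems mu by simp
  qed
qed

section \<open>Interpretation of types over the ordinal \<open>\<omega>\<^sup>2\<close>\<close>

type_synonym 'w family = "'w \<Rightarrow> lterm set"

text \<open>The default \<open>{}\<close> from \<open>p\<close> upwards keeps decreasing families
  decreasing and preserves closure under head expansion.\<close>

definition below :: "'w::wellorder \<Rightarrow> 'w family \<Rightarrow> 'w family" where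
  "below p S = (\<lambda>q. if q < p then S q else {})"

text \<open>\<open>F\<close> only ever sees a truncation, so the recursion is well-founded for every
  \<open>F\<close>. For a proper body the truncation turns out to be invisible.\<close>

function guarded_fix :: "('w::wellorder family \<Rightarrow> 'w family) \<Rightarrow> 'w family" where
  "guarded_fix F p = F (\<lambda>q. if q < p then guarded_fix F q else {}) p"
  by auto
termination
  by (relation "inv_image {(p, q). p < q} snd") (auto intro: wf)

declare guarded_fix.simps [simp del]

lemma guarded_fix_eq: "guarded_fix F p = F (below p (guarded_fix F)) p"
  by (subst guarded_fix.simps) (simp add: below_def)

definition push :: "'w family \<Rightarrow> (tatom \<Rightarrow> 'w family) \<Rightarrow> tatom \<Rightarrow> 'w family" where
  "push S e a = (case a of AF x \<Rightarrow> e (AF x) | AB i \<Rightarrow> (case i of 0 \<Rightarrow> S | Suc j \<Rightarrow> e (AB j)))"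

lemma push_simps [simp]:
  "push S e (AF x) = e (AF x)" "push S e (AB 0) = S" "push S e (AB (Suc i)) = e (AB i)"
  by (simp_all add: push_def)

lemma push_fun_upd_AF: "push S (e(AF X := T)) = (push S e)(AF X := T)"
  by (auto simp: push_def fun_eq_iff split: tatom.splits nat.splits)

text \<open>A Kripke function space over all smaller worlds, and a modality over the strictly
  smaller ones. Arguments are locally closed because they end up as arguments of head normal forms,
  where \<open>max_upto\<close> asks for this.\<close>

primrec sem :: "ty \<Rightarrow> (tatom \<Rightarrow> 'w::wellorder family) \<Rightarrow> 'w family" where
  "sem (TFVar x) e = e (AF x)"
| "sem (TBVar i) e = e (AB i)"
| "sem (Arr A B) e = (\<lambda>p. {M. \<forall>q\<le>p. \<forall>N\<in>sem A e q. lc N \<longrightarrow> App M N \<in> sem B e q})"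
| "sem (Later A) e = (\<lambda>p. {M. \<forall>q<p. M \<in> sem A e q})"
| "sem (Mu A) e = guarded_fix (\<lambda>S. sem A (push S e))"

section \<open>Closing and substitution as changes of the environment\<close>

lemma sem_cong:
  "lcT k A \<Longrightarrow> (\<And>x. x \<in> fvT A \<Longrightarrow> e (AF x) = e' (AF x)) \<Longrightarrow> (\<And>i. i < k \<Longrightarrow> e (AB i) = e' (AB i))
    \<Longrightarrow> sem A e = sem A e'"
proof (induction A arbitrary: k e e')
  case (Arr A B)
  have "sem A e = sem A e'" "sem B e = sem B e'"
    using Arr.prems by (auto intro: Arr.IH[of k])
  then show ?case by simp
next
  case (Later A)
  have "sem A e = sem A e'"
    using Later.prems by (auto intro: Later.IH[of k])
  then show ?case by simp
next
  case (Mu A)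
  have "sem A (push S e) = sem A (push S e')" for S
  proof (rule Mu.IH[of "Suc k"])
    fix i assume "i < Suc k"
    then show "push S e (AB i) = push S e' (AB i)"
      using Mu.prems(3) by (cases i) auto
  qed (use Mu.prems in auto)
  then show ?case by simp
qed auto

lemma sem_closeT: "sem (closeT k X A) e = sem A (e(AF X := e (AB k)))"
  by (induction A arbitrary: k e) (auto simp: push_fun_upd_AF)

lemma sem_push_closed: "lcT 0 C \<Longrightarrow> sem C (push S e) = sem C e"
  by (rule sem_cong[of 0]) auto

lemma sem_substT: "lcT 0 C \<Longrightarrow> sem (substT X C A) e = sem A (e(AF X := sem C e))"
  by (induction A arbitrary: e) (auto simp: push_fun_upd_AF sem_push_closed)

lemma sem_Mu_closeT:
  assumes "lcT 0 A"
  shows "sem (Mu (closeT 0 X A)) e = guarded_fix (\<lambda>S. sem A (e(AF X := S)))"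
proof -
  have "sem (closeT 0 X A) (push S e) = sem A (e(AF X := S))" for S
    unfolding sem_closeT using assms by (intro sem_cong[of 0]) auto
  then show ?thesis by simp
qed

section \<open>Dependence on worlds: locality, top-variants and properness\<close>

lemma sem_local:
  "(\<And>a q. q \<le> p \<Longrightarrow> e a q = e' a q) \<Longrightarrow> sem A e p = sem A e' p"
proof (induction A arbitrary: e e' p)
  case (Arr A B)
  have "sem A e q = sem A e' q" "sem B e q = sem B e' q" if "q \<le> p" for q
    using Arr.prems that by (auto intro!: Arr.IH)
  then show ?case by auto
next
  case (Later A)
  have "sem A e q = sem A e' q" if "q < p" for q
    using Later.prems that by (auto intro!: Later.IH)
  then show ?case by auto
next
  case (Mu A)
  \<comment> \<open>The fixed point at \<open>p\<close> is computed from its values below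
    \<open>p\<close>, hence an inner induction on the world.\<close>
  from Mu.prems show ?case
  proof (induction p rule: less_induct)
    case (less p)
    let ?S = "guarded_fix (\<lambda>S. sem A (push S e))" and ?S' = "guarded_fix (\<lambda>S. sem A (push S e'))"
    have "?S q = ?S' q" if "q < p" for q
      using less.IH[OF that] less.prems that by simp
    then have "below p ?S = below p ?S'"
      by (auto simp: below_def fun_eq_iff)
    then have "sem A (push (below p ?S) e) p = sem A (push (below p ?S') e') p"
      using less.prems by (intro Mu.IH) (auto simp: push_def split: tatom.splits nat.splits)
    then show ?case by (simp add: guarded_fix_eq[of _ p])
  qed
qed auto

text \<open>The flags of \<open>ctx\<close> become semantic: an index whose binder has not yet
  passed a bullet is full only strictly below \<open>p\<close>, the others also at \<open>p\<close>.
  A bullet moves to a strictly smaller world, where all of them are full.\<close>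

lemma sem_tvar:
  "tvar ctx A \<Longrightarrow> (\<And>k q. k < length ctx \<Longrightarrow> q < p \<or> q = p \<and> ctx ! k \<Longrightarrow> e (AB k) q = UNIV)
    \<Longrightarrow> sem A e p = UNIV"
proof (induction A arbitrary: ctx e p)
  case (Arr A B)
  have "sem B e q = UNIV" if "q \<le> p" for q
  proof (rule Arr.IH(2)[of ctx])
    fix k r assume k: "k < length ctx" and "r < q \<or> r = q \<and> ctx ! k"
    then have "r < p \<or> r = p \<and> ctx ! k"
      using that by (metis order.strict_trans2 le_less)
    then show "e (AB k) r = UNIV" using Arr.prems(2) k by blast
  qed (use Arr.prems in simp)
  then show ?case by auto
next
  case (Later A)
  have "sem A e q = UNIV" if "q < p" for q
  proof (rule Later.IH[of "map (\<lambda>_. True) ctx"])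
    fix k r assume k: "k < length (map (\<lambda>_. True) ctx)"
      and "r < q \<or> r = q \<and> map (\<lambda>_. True) ctx ! k"
    then have "r < p" using that by (metis order.strict_trans)
    then show "e (AB k) r = UNIV" using Later.prems(2) k by simp
  qed (use Later.prems in simp)
  then show ?case by auto
next
  case (Mu A)
  from Mu.prems show ?case
  proof (induction p rule: less_induct)
    case (less p)
    let ?S = "guarded_fix (\<lambda>S. sem A (push S e))"
    have S: "?S q = UNIV" if "q < p" for q
    proof -
      have "e (AB k) r = UNIV" if "k < length ctx" "r < q \<or> r = q \<and> ctx ! k" for k r
        using less.prems(2)[of k r] that \<open>q < p\<close> by (metis order.strict_trans)
      then have "sem (Mu A) e q = UNIV"
        using less.IH[OF \<open>q < p\<close> less.prems(1)] by blast
      then show ?thesis by simp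
    qed
    have "sem A (push (below p ?S) e) p = UNIV"
    proof (rule Mu.IH[of "False # ctx"])
      fix k q assume "k < length (False # ctx)" "q < p \<or> q = p \<and> (False # ctx) ! k"
      then show "push (below p ?S) e (AB k) q = UNIV"
        using less.prems S by (cases k) (auto simp: below_def)
    qed (use less.prems in simp)
    then show ?case by (simp add: guarded_fix_eq[of _ p])
  qed
qed auto

lemma sem_top_variant: "top_variant A \<Longrightarrow> sem A e p = UNIV"
  unfolding top_variant_def by (rule sem_tvar) auto

lemma sem_Top: "sem Top e p = UNIV"
  by (rule sem_top_variant) (simp add: Top_def top_variant_def)

text \<open>Properness hides \<open>X\<close> under a bullet, which looks only at strictly smaller
  worlds, or inside a top-variant, which denotes all terms whatever the environment.\<close>

lemma sem_proper:
  "proper X A \<Longrightarrow> (\<And>a q. q \<le> p \<Longrightarrow> a \<noteq> AF X \<or> q < p \<Longrightarrow> e a q = e' a q)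
    \<Longrightarrow> sem A e p = sem A e' p"
proof (induction A arbitrary: e e' p)
  case (Arr A B)
  show ?case
  proof (cases "top_variant B")
    case True
    then show ?thesis by (simp add: sem_top_variant)
  next
    case False
    have eq: "sem A e q = sem A e' q \<and> sem B e q = sem B e' q" if "q \<le> p" for q
    proof -
      have "e a r = e' a r" if "r \<le> q" "a \<noteq> AF X \<or> r < q" for a r
        using Arr.prems(2)[of r a] that \<open>q \<le> p\<close> by (meson order.trans order.strict_trans2)
      then show ?thesis using Arr.IH Arr.prems(1) False by (metis proper.simps(4))
    qed
    show ?thesis using eq by simp
  qed
next
  case (Later A)
  have "sem A e q = sem A e' q" if "q < p" for q
  proof (rule sem_local)
    fix a r assume "r \<le> q"
    then have "r < p" using that by (rule order.strict_trans1)
    then show "e a r = e' a r" using Later.prems(2) by simp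
  qed
  then show ?case by auto
next
  case (Mu A)
  show ?case
  proof (cases "top_variant (Mu A)")
    case True
    then show ?thesis using sem_top_variant by blast
  next
    case False
    with Mu.prems(1) have "proper X A" by simp
    from Mu.prems(2) show ?thesis
    proof (induction p rule: less_induct)
      case (less p)
      let ?S = "guarded_fix (\<lambda>S. sem A (push S e))" and ?S' = "guarded_fix (\<lambda>S. sem A (push S e'))"
      have "?S q = ?S' q" if "q < p" for q
      proof -
        have "e a r = e' a r" if "r \<le> q" for a r
          using less.prems[of r a] that \<open>q < p\<close> order.strict_trans1[of r q p] by simp
        then have "sem (Mu A) e q = sem (Mu A) e' q"
          using less.IH[OF \<open>q < p\<close>] by blast
        then show ?thesis by simp
      qed
      then have "below p ?S = below p ?S'"
        by (auto simp: below_def fun_eq_iff)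
      then have "sem A (push (below p ?S) e) p = sem A (push (below p ?S') e') p"
        using less.prems \<open>proper X A\<close>
        by (intro Mu.IH) (auto simp: push_def split: tatom.splits nat.splits)
      then show ?case by (simp add: guarded_fix_eq[of _ p])
    qed
  qed
qed auto

text \<open>By properness the body at \<open>p\<close> cannot tell the fixed point from its
  truncation below \<open>p\<close>.\<close>

lemma sem_Mu_eq:
  assumes "proper X A" "lcT 0 A"
  shows "sem (Mu (closeT 0 X A)) e = sem A (e(AF X := sem (Mu (closeT 0 X A)) e))"
proof
  fix p
  let ?S = "guarded_fix (\<lambda>S. sem A (e(AF X := S)))"
  have "?S p = sem A (e(AF X := below p ?S)) p"
    by (rule guarded_fix_eq)
  also have "\<dots> = sem A (e(AF X := ?S)) p"
    by (rule sem_proper[OF assms(1)]) (auto simp: below_def)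
  finally show "sem (Mu (closeT 0 X A)) e p = sem A (e(AF X := sem (Mu (closeT 0 X A)) e)) p"
    by (simp only: sem_Mu_closeT[OF assms(2)])
qed

lemma sem_unfold:
  assumes "wfty (Mu A)"
  shows "sem (openT 0 (Mu A) A) e = sem (Mu A) e"
proof -
  obtain X B where A: "A = closeT 0 X B" and B: "wfty B" "proper X B"
    using assms by (auto elim: wfty_MuE)
  have "sem (openT 0 (Mu A) A) e = sem B (e(AF X := sem (Mu A) e))"
    using B assms A by (simp only: openT_closeT wfty_lcT sem_substT)
  then show ?thesis
    using sem_Mu_eq[of X B e] assms A B wfty_lcT by simp
qed

section \<open>Decreasing families and successor worlds\<close>

definition hereditary :: "'w::wellorder family \<Rightarrow> bool" where
  "hereditary S \<longleftrightarrow> (\<forall>p q. q \<le> p \<longrightarrow> S p \<subseteq> S q)"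

lemma hereditary_below:
  assumes "\<And>r q. r < p \<Longrightarrow> q \<le> r \<Longrightarrow> S r \<subseteq> S q"
  shows "hereditary (below p S)"
  unfolding hereditary_def
proof (intro allI impI)
  fix r q :: 'a
  assume "q \<le> r"
  then show "below p S r \<subseteq> below p S q"
    using assms order.strict_trans1[of q r p] by (simp add: below_def)
qed

lemma below_mono: "(\<And>q. q < p \<Longrightarrow> S q \<subseteq> T q) \<Longrightarrow> below p S q \<subseteq> below p T q"
  by (simp add: below_def)

lemma sem_hereditary: "wfty A \<Longrightarrow> \<forall>a. hereditary (e a) \<Longrightarrow> hereditary (sem A e)"
proof (induction arbitrary: e rule: wfty.induct)
  case (wf_arr A B)
  show ?case by (auto simp: hereditary_def dest: order.trans)
next
  case (wf_later A)
  show ?case by (auto simp: hereditary_def dest: order.strict_trans2)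
next
  case (wf_mu A X)
  let ?S = "guarded_fix (\<lambda>S. sem A (e(AF X := S)))"
  have "\<forall>q\<le>p. ?S p \<subseteq> ?S q" for p
  proof (induction p rule: less_induct)
    case (less p)
    have "hereditary (below p ?S)"
      using less.IH by (intro hereditary_below) blast
    then have H: "hereditary (sem A (e(AF X := below p ?S)))"
      using wf_mu.IH wf_mu.prems by simp
    show ?case
    proof (intro allI impI)
      fix q assume "q \<le> p"
      have "?S p = sem A (e(AF X := below p ?S)) p"
        by (rule guarded_fix_eq)
      also have "\<dots> \<subseteq> sem A (e(AF X := below p ?S)) q"
        using H \<open>q \<le> p\<close> by (simp add: hereditary_def)
      \<comment> \<open>By properness only values strictly below \<open>q\<close> matter at
        \<open>q\<close>, and there the two truncations agree.\<close>
      also have "\<dots> = sem A (e(AF X := below q ?S)) q"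
        using \<open>q \<le> p\<close> by (intro sem_proper[OF wf_mu.hyps(2)]) (auto simp: below_def)
      also have "\<dots> = ?S q"
        by (rule guarded_fix_eq[symmetric])
      finally show "?S p \<subseteq> ?S q" .
    qed
  qed
  then show ?case
    using wf_mu.hyps(1) by (simp add: sem_Mu_closeT wfty_lcT hereditary_def del: sem.simps)
qed auto

definition next_world :: "'w::{wellorder, no_top} \<Rightarrow> 'w" where
  "next_world p = (LEAST q. p < q)"

lemma less_next_world: "q < next_world p \<longleftrightarrow> q \<le> p"
proof
  assume "q < next_world p"
  then show "q \<le> p"
    unfolding next_world_def using not_less_Least not_less by blast
next
  have "p < next_world p"
    unfolding next_world_def by (rule LeastI_ex) (rule gt_ex)
  moreover assume "q \<le> p"
  ultimately show "q < next_world p" by simp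
qed

text \<open>The worlds strictly below the successor of \<open>p\<close> are those up to
  \<open>p\<close>, and for a decreasing family the condition at \<open>p\<close> implies the
  others.\<close>

lemma sem_Later_next:
  fixes e :: "tatom \<Rightarrow> 'w::{wellorder, no_top} family"
  shows "hereditary (sem A e) \<Longrightarrow> sem (Later A) e (next_world p) = sem A e p"
  by (auto simp: less_next_world hereditary_def)

section \<open>Soundness of type equality and subtyping\<close>

lemma ty_eq_sound:
  fixes e :: "tatom \<Rightarrow> 'w::{wellorder, no_top} family"
  shows "ty_eq d A B \<Longrightarrow> \<forall>a. hereditary (e a) \<Longrightarrow> sem A e = sem B e"
proof (induction arbitrary: e rule: ty_eq.induct)
  case (eq_top A)
  show ?case by (auto simp: sem_Top fun_eq_iff)
next
  case (eq_unfold A)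
  then show ?case by (simp only: sem_unfold)
next
  case (eq_contr A C X)
  have fixp: "sem A e = sem C (e(AF X := sem A e))"
    using eq_contr.IH[OF eq_contr.prems] sem_substT[OF wfty_lcT[OF eq_contr.hyps(1)]] by metis
  define T where "T = guarded_fix (\<lambda>S. sem C (e(AF X := S)))"
  have T: "T p = sem C (e(AF X := below p T)) p" for p
    unfolding T_def by (rule guarded_fix_eq)
  \<comment> \<open>Uniqueness of guarded fixed points: every solution of the equation agrees with
    \<open>T\<close>, world by world.\<close>
  have "sem A e p = T p" for p
  proof (induction p rule: less_induct)
    case (less p)
    have "sem A e p = sem C (e(AF X := sem A e)) p"
      by (subst fixp) simp
    also have "\<dots> = sem C (e(AF X := below p T)) p"
      using less by (intro sem_proper[OF eq_contr.hyps(3)]) (auto simp: below_def)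
    finally show ?case by (simp only: T)
  qed
  then show ?case
    using eq_contr.hyps by (simp add: sem_Mu_closeT wfty_lcT fun_eq_iff T_def[symmetric] del: sem.simps)
next
  case (eq_dist A B)
  have hA: "hereditary (sem A e)"
    using eq_dist by (simp add: sem_hereditary)
  show ?case
  proof (intro ext set_eqI iffI)
    fix p M assume "M \<in> sem (Later (Arr A B)) e p"
    then show "M \<in> sem (Arr (Later A) (Later B)) e p"
      by (auto dest: order.strict_trans2)
  next
    \<comment> \<open>To test \<open>M\<close> at some \<open>q < p\<close>, apply it at the
      successor of \<open>q\<close>, which is still at most \<open>p\<close> and where a bullet
      means membership at \<open>q\<close>.\<close>
    fix p M assume M: "M \<in> sem (Arr (Later A) (Later B)) e p"
    have "App M N \<in> sem B e q" if "q < p" "N \<in> sem A e q" "lc N" for q N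
    proof -
      have "next_world q \<le> p"
        using that(1) less_next_world[of p q] by (simp add: not_less[symmetric])
      moreover have "N \<in> sem (Later A) e (next_world q)"
        using that(2) sem_Later_next[OF hA] by blast
      ultimately have "App M N \<in> sem (Later B) e (next_world q)"
        using M \<open>lc N\<close> by simp
      then show ?thesis by (simp add: less_next_world)
    qed
    then show "M \<in> sem (Later (Arr A B)) e p"
      by auto
  qed
qed auto

lemma sub_sound:
  fixes e :: "tatom \<Rightarrow> 'w::{wellorder, no_top} family"
  shows "sub \<gamma> A B \<Longrightarrow> \<forall>a. hereditary (e a) \<Longrightarrow> \<forall>(X, Y)\<in>\<gamma>. \<forall>q. e (AF X) q \<subseteq> e (AF Y) q
    \<Longrightarrow> sem A e p \<subseteq> sem B e p"
proof (induction arbitrary: e p rule: sub.induct)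
  case (sub_top \<gamma> A)
  show ?case by (simp add: sem_Top)
next
  case (sub_eq \<gamma> A B)
  then have "sem A e = sem B e" by (intro ty_eq_sound)
  then show ?case by simp
next
  case (sub_trans \<gamma>1 A B \<gamma>2 C)
  then show ?case by (meson UnCI subset_trans)
next
  case (sub_later \<gamma> A B)
  then have "sem A e q \<subseteq> sem B e q" for q by blast
  then show ?case by auto
next
  case (sub_arr \<gamma>1 A' A \<gamma>2 B B')
  have "sem A' e q \<subseteq> sem A e q" "sem B e q \<subseteq> sem B' e q" for q
    using sub_arr.IH sub_arr.prems by auto
  then show ?case by (simp add: subset_eq)
next
  case (sub_mu X Y \<gamma> A B)
  have wf: "wfty A" "wfty B" using sub_wfty sub_mu.hyps(1) by auto
  have XY: "X \<noteq> Y" using sub_mu.hyps(2) by (simp add: wf_assum_def)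
  define S where "S = guarded_fix (\<lambda>S. sem A (e(AF X := S)))"
  define T where "T = guarded_fix (\<lambda>S. sem B (e(AF Y := S)))"
  have S: "S p = sem A (e(AF X := below p S)) p" and T: "T p = sem B (e(AF Y := below p T)) p" for p
    unfolding S_def T_def by (rule guarded_fix_eq)+
  have hS: "hereditary S" 
    using sem_hereditary[OF wfty.wf_mu[OF wf(1) sub_mu.hyps(5)] sub_mu.prems(1)] wf
    by (simp only: sem_Mu_closeT wfty_lcT S_def T_def)
  have hT: "hereditary T" 
    using sem_hereditary[OF wfty.wf_mu[OF wf(2) sub_mu.hyps(6)] sub_mu.prems(1)] wf
    by (simp only: sem_Mu_closeT wfty_lcT S_def T_def)
  have "S p \<subseteq> T p"
  proof (induction p rule: less_induct)
    case (less p)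
    \<comment> \<open>The discharged assumption on \<open>X\<close> and \<open>Y\<close> is read as
      an inclusion of the fixed points truncated at \<open>p\<close>, which the induction on worlds
      provides.\<close>
    let ?e = "e(AF X := below p S, AF Y := below p T)"
    have h: "hereditary (below p U)" if "hereditary U" for U
      using that by (intro hereditary_below) (simp add: hereditary_def)
    have assm: "\<forall>(Z, W)\<in>insert (X, Y) \<gamma>. \<forall>q. ?e (AF Z) q \<subseteq> ?e (AF W) q"
    proof -
      have "\<forall>q. ?e (AF X) q \<subseteq> ?e (AF Y) q"
      proof -
        have "?e (AF X) = below p S" "?e (AF Y) = below p T" using XY by auto
        then show ?thesis using below_mono[of p S T, OF less.IH] by presburger
      qed
      moreover have "\<forall>q. ?e (AF Z) q \<subseteq> ?e (AF W) q" if "(Z, W) \<in> \<gamma>" for Z W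
      proof -
        have "{Z, W} \<subseteq> ftv_assum \<gamma>" using that by (force simp: ftv_assum_def)
        then have "X \<notin> {Z, W}" "Y \<notin> {Z, W}" using sub_mu.hyps(3,4) by auto
        moreover have "\<forall>q. e (AF Z) q \<subseteq> e (AF W) q"
          using sub_mu.prems(2) that by blast
        ultimately show ?thesis by auto
      qed
      ultimately show ?thesis by blast
    qed
    \<comment> \<open>\<open>Y\<close> is not free in \<open>A\<close> and \<open>X\<close> not in
      \<open>B\<close>, so both bodies can be read in one environment.\<close>
    have "sem A (e(AF X := below p S)) = sem A ?e"
      using sub_mu.hyps(4) wfty_lcT[OF wf(1)] by (intro sem_cong[of 0]) auto
    moreover have "sem B (e(AF Y := below p T)) = sem B ?e"
      using sub_mu.hyps(3) wfty_lcT[OF wf(2)] XY by (intro sem_cong[of 0]) auto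
    moreover have "sem A ?e p \<subseteq> sem B ?e p"
      using assm sub_mu.prems(1) h hS hT by (intro sub_mu.IH) auto
    ultimately show ?case
      by (simp only: S[of p] T[of p])
  qed
  then show ?case using wf by (simp only: sem_Mu_closeT wfty_lcT S_def T_def)
next
  case (sub_shift \<gamma> A)
  then have "hereditary (sem A e)" by (simp add: sem_hereditary)
  then show ?case unfolding hereditary_def by (auto dest: less_imp_le)
qed auto

section \<open>Weak head reduction and head normal forms\<close>

fun fvL :: "lterm \<Rightarrow> nat set" where
  "fvL (Var x) = {x}"
| "fvL (BVar i) = {}"
| "fvL (Lam M) = fvL M"
| "fvL (App M N) = fvL M \<union> fvL N"

fun ren :: "(nat \<Rightarrow> nat) \<Rightarrow> lterm \<Rightarrow> lterm" where
  "ren f (Var x) = Var (f x)"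
| "ren f (BVar i) = BVar i"
| "ren f (Lam M) = Lam (ren f M)"
| "ren f (App M N) = App (ren f M) (ren f N)"

fun substL :: "(nat \<Rightarrow> lterm) \<Rightarrow> lterm \<Rightarrow> lterm" where
  "substL \<sigma> (Var x) = \<sigma> x"
| "substL \<sigma> (BVar i) = BVar i"
| "substL \<sigma> (Lam M) = Lam (substL \<sigma> M)"
| "substL \<sigma> (App M N) = App (substL \<sigma> M) (substL \<sigma> N)"

inductive whr :: "lterm \<Rightarrow> lterm \<Rightarrow> bool" where
  whr_beta: "whr (App (Lam M) N) (openL 0 N M)"
| whr_app: "whr M M' \<Longrightarrow> whr (App M N) (App M' N)"

inductive_cases whr_AppE: "whr (App M N) R"
inductive_cases whr_LamE: "whr (Lam M) R"
inductive_cases whr_VarE: "whr (Var x) R"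

text \<open>Head reduction under binders, done by opening each abstraction with a fresh name. The
  names chosen are recorded in the list.\<close>

inductive hnf :: "lterm \<Rightarrow> nat list \<Rightarrow> nat \<Rightarrow> lterm list \<Rightarrow> bool" where
  hnf_neutral: "whr\<^sup>*\<^sup>* M (apps (Var y) Ns) \<Longrightarrow> hnf M [] y Ns"
| hnf_lam: "whr\<^sup>*\<^sup>* M (Lam P) \<Longrightarrow> x \<notin> fvL P \<Longrightarrow> hnf (openL 0 (Var x) P) xs y Ns
    \<Longrightarrow> hnf M (x # xs) y Ns"

lemma apps_snoc: "apps h (Ns @ [N]) = App (apps h Ns) N"
  by (simp add: apps_def)

lemma apps_Nil [simp]: "apps h [] = h"
  by (simp add: apps_def)

lemma finite_fvL [simp]: "finite (fvL M)"
  by (induction M) auto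

lemma fvL_openL: "fvL (openL k N M) \<subseteq> fvL M \<union> fvL N"
  by (induction M arbitrary: k) auto

lemma whr_fvL: "whr M M' \<Longrightarrow> fvL M' \<subseteq> fvL M"
  by (induction rule: whr.induct) (use fvL_openL in auto)

lemma whrs_fvL: "whr\<^sup>*\<^sup>* M M' \<Longrightarrow> fvL M' \<subseteq> fvL M"
  by (induction rule: rtranclp_induct) (use whr_fvL in blast)+

lemma ren_openL: "ren f (openL k N M) = openL k (ren f N) (ren f M)"
  by (induction M arbitrary: k) auto

lemma ren_apps: "ren f (apps h Ns) = apps (ren f h) (map (ren f) Ns)"
  by (induction Ns rule: rev_induct) (auto simp: apps_snoc)

lemma fvL_ren: "fvL (ren f M) = f ` fvL M"
  by (induction M) auto

lemma lc_at_ren [simp]: "lc_at k (ren f M) = lc_at k M"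
  by (induction M arbitrary: k) auto

lemma ren_cong_id: "(\<And>x. x \<in> fvL M \<Longrightarrow> f x = x) \<Longrightarrow> ren f M = M"
  by (induction M) auto

lemma ren_ren: "ren f (ren g M) = ren (f \<circ> g) M"
  by (induction M) auto

lemma whr_ren: "whr M M' \<Longrightarrow> whr (ren f M) (ren f M')"
  by (induction rule: whr.induct) (auto simp: ren_openL intro: whr.intros)

lemma whrs_ren: "whr\<^sup>*\<^sup>* M M' \<Longrightarrow> whr\<^sup>*\<^sup>* (ren f M) (ren f M')"
  by (induction rule: rtranclp_induct) (auto intro: whr_ren rtranclp.rtrancl_into_rtrancl)

lemma hnf_ren:
  "hnf M xs y Ns \<Longrightarrow> bij f \<Longrightarrow> hnf (ren f M) (map f xs) (f y) (map (ren f) Ns)"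
proof (induction rule: hnf.induct)
  case (hnf_neutral M y Ns)
  then show ?case using whrs_ren[of M "apps (Var y) Ns" f] by (simp add: ren_apps hnf.hnf_neutral)
next
  case (hnf_lam M P x xs y Ns)
  have "whr\<^sup>*\<^sup>* (ren f M) (Lam (ren f P))"
    using whrs_ren[OF hnf_lam.hyps(1), of f] by simp
  moreover have "f x \<notin> fvL (ren f P)"
    using hnf_lam by (auto simp: fvL_ren bij_def dest: injD)
  ultimately show ?case
    using hnf_lam by (auto simp: ren_openL intro: hnf.hnf_lam)
qed

section \<open>Determinism and uniqueness of head normal forms\<close>

lemma whr_det: "whr M A \<Longrightarrow> whr M B \<Longrightarrow> A = B"
proof (induction arbitrary: B rule: whr.induct)
  case (whr_beta M N)
  then show ?case by (rule whr_AppE) (auto elim: whr_LamE)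
next
  case (whr_app M M' N)
  from whr_app.prems show ?case
    by (rule whr_AppE) (use whr_app.hyps whr_app.IH in \<open>blast elim: whr_LamE\<close>)+
qed

lemma whrs_unique:
  "whr\<^sup>*\<^sup>* M A \<Longrightarrow> whr\<^sup>*\<^sup>* M B \<Longrightarrow> \<nexists>R. whr A R \<Longrightarrow> \<nexists>R. whr B R \<Longrightarrow> A = B"
proof (induction rule: converse_rtranclp_induct)
  case base
  then show ?case by (metis converse_rtranclpE)
next
  case (step M M')
  then show ?case by (metis converse_rtranclpE whr_det)
qed

lemma whr_normal_Lam: "\<nexists>R. whr (Lam P) R"
  by (auto elim: whr_LamE)

lemma apps_Var_neq_Lam: "apps (Var y) Ns \<noteq> Lam P"
  by (induction Ns rule: rev_induct) (auto simp: apps_snoc)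

lemma whr_normal_apps: "\<nexists>R. whr (apps (Var y) Ns) R"
proof (induction Ns rule: rev_induct)
  case (snoc N Ns)
  then show ?case by (auto simp: apps_snoc apps_Var_neq_Lam elim!: whr_AppE dest: sym)
qed (auto elim: whr_VarE)

lemma apps_Var_inject: "apps (Var y) Ns = apps (Var y') Ns' \<Longrightarrow> y = y' \<and> Ns = Ns'"
proof (induction Ns arbitrary: Ns' rule: rev_induct)
  case Nil
  then show ?case by (cases Ns' rule: rev_cases) (auto simp: apps_snoc)
next
  case (snoc N Ns)
  then show ?case by (cases Ns' rule: rev_cases) (auto simp: apps_snoc)
qed

text \<open>Weak head reduction is deterministic, so two derivations differ only in the names used
  to open abstractions; a bijection of names relates the arguments.\<close>

lemma hnf_unique:
  "hnf M xs y Ns \<Longrightarrow> hnf M xs' y' Ns' \<Longrightarrow> \<exists>f. bij f \<and> Ns' = map (ren f) Ns"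
proof (induction arbitrary: xs' y' Ns' rule: hnf.induct)
  case (hnf_neutral M y Ns)
  from hnf_neutral.prems have "Ns' = Ns"
  proof cases
    case hnf_neutral': hnf_neutral
    then show ?thesis
      using apps_Var_inject whrs_unique[OF hnf_neutral.hyps hnf_neutral'(2)]
      by (metis whr_normal_apps)
  next
    case (hnf_lam P x xs)
    then show ?thesis
      using whrs_unique[OF hnf_neutral.hyps hnf_lam(2)] apps_Var_neq_Lam whr_normal_apps whr_normal_Lam
      by metis
  qed
  then have "bij id \<and> Ns' = map (ren id) Ns"
    by (simp add: ren_cong_id map_idI)
  then show ?case by blast
next
  case (hnf_lam M P x xs y Ns)
  from hnf_lam.prems obtain x' xs'' where x': "x' \<notin> fvL P"
    and h': "hnf (openL 0 (Var x') P) xs'' y' Ns'"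
  proof cases
    case hnf_neutral
    then show ?thesis
      using whrs_unique[OF hnf_lam.hyps(1) hnf_neutral(2)] apps_Var_neq_Lam whr_normal_apps whr_normal_Lam
      by metis
  next
    case hnf_lam': (hnf_lam P' x' xs'')
    then have "P' = P"
      using whrs_unique[OF hnf_lam.hyps(1) hnf_lam'(2)] whr_normal_Lam by blast
    then show ?thesis using hnf_lam' that by blast
  qed
  \<comment> \<open>The swap of the two binder names. Both are fresh for \<open>P\<close>, so it
    exchanges the two openings of \<open>P\<close>.\<close>
  define g where "g = (\<lambda>z. if z = x then x' else if z = x' then x else z)"
  have gg: "g \<circ> g = id" by (auto simp: g_def fun_eq_iff)
  then have "bij g" by (simp add: o_bij)
  have "ren g P = P"
    using x' hnf_lam.hyps(2) by (intro ren_cong_id) (auto simp: g_def)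
  then have "ren g (openL 0 (Var x') P) = openL 0 (Var x) P"
    by (simp add: ren_openL) (simp add: g_def)
  then have "hnf (openL 0 (Var x) P) (map g xs'') (g y') (map (ren g) Ns')"
    using hnf_ren[OF h' \<open>bij g\<close>] by simp
  then obtain f where f: "bij f" "map (ren g) Ns' = map (ren f) Ns"
    using hnf_lam.IH by blast
  have "Ns' = map (ren g) (map (ren g) Ns')"
    using gg by (simp add: ren_ren ren_cong_id map_idI)
  also have "\<dots> = map (ren (g \<circ> f)) Ns"
    by (simp add: f(2) ren_ren)
  finally show ?case using \<open>bij g\<close> f(1) bij_comp by blast
qed

lemma lc_at_mono: "lc_at k M \<Longrightarrow> k \<le> l \<Longrightarrow> lc_at l M"
  by (induction M arbitrary: k l) auto

lemma lc_at_openL: "lc_at (Suc k) M \<Longrightarrow> lc N \<Longrightarrow> lc_at k (openL k N M)"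
  by (induction M arbitrary: k) (auto intro: lc_at_mono)

lemma whr_lc: "whr M M' \<Longrightarrow> lc M \<Longrightarrow> lc M'"
  by (induction rule: whr.induct) (auto intro: lc_at_openL)

lemma whr_imp_beta: "whr M M' \<Longrightarrow> lc M \<Longrightarrow> beta M M'"
  by (induction rule: whr.induct) (auto intro: beta.intros)

lemma whrs_imp_betas: "whr\<^sup>*\<^sup>* M M' \<Longrightarrow> lc M \<Longrightarrow> beta\<^sup>*\<^sup>* M M' \<and> lc M'"
  by (induction rule: rtranclp_induct)
    (auto intro: whr_lc whr_imp_beta rtranclp.rtrancl_into_rtrancl)

lemma betas_Lam_closeL:
  "beta\<^sup>*\<^sup>* M M' \<Longrightarrow> beta\<^sup>*\<^sup>* (Lam (closeL 0 x M)) (Lam (closeL 0 x M'))"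
  by (induction rule: rtranclp_induct) (auto intro: b_lam rtranclp.rtrancl_into_rtrancl)

lemma closeL_openL: "x \<notin> fvL M \<Longrightarrow> closeL k x (openL k (Var x) M) = M"
  by (induction M arbitrary: k) auto

lemma hnf_imp_betas: "hnf M xs y Ns \<Longrightarrow> lc M \<Longrightarrow> beta\<^sup>*\<^sup>* M (lams xs (apps (Var y) Ns))"
proof (induction rule: hnf.induct)
  case (hnf_neutral M y Ns)
  then show ?case by (simp add: whrs_imp_betas)
next
  case (hnf_lam M P x xs y Ns)
  have M: "beta\<^sup>*\<^sup>* M (Lam P)" and P: "lc (Lam P)"
    using whrs_imp_betas[OF hnf_lam.hyps(1) hnf_lam.prems] by auto
  have "lc (openL 0 (Var x) P)"
    using P by (intro lc_at_openL) auto
  then have "beta\<^sup>*\<^sup>* (Lam (closeL 0 x (openL 0 (Var x) P))) (lams (x # xs) (apps (Var y) Ns))"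
    using betas_Lam_closeL[OF hnf_lam.IH] by simp
  then show ?case
    using M hnf_lam.hyps(2) by (simp add: closeL_openL)
qed

lemma whrs_App_cases:
  "whr\<^sup>*\<^sup>* (App M N) R \<Longrightarrow> (\<exists>M'. whr\<^sup>*\<^sup>* M M' \<and> R = App M' N)
    \<or> (\<exists>P. whr\<^sup>*\<^sup>* M (Lam P) \<and> whr\<^sup>*\<^sup>* (openL 0 N P) R)"
proof (induction rule: rtranclp_induct)
  case base
  then show ?case by blast
next
  case (step R R')
  from step.IH show ?case
  proof
    assume "\<exists>M'. whr\<^sup>*\<^sup>* M M' \<and> R = App M' N"
    then obtain M' where "whr\<^sup>*\<^sup>* M M'" "whr (App M' N) R'"
      using step.hyps(2) by blast
    then show ?thesis
      by (auto elim!: whr_AppE intro: rtranclp.rtrancl_into_rtrancl)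
  qed (use step.hyps(2) in \<open>auto intro: rtranclp.rtrancl_into_rtrancl\<close>)
qed

text \<open>Either \<open>M\<close> itself becomes neutral, and \<open>z\<close> is the last
  argument of the spine, or \<open>M\<close> becomes an abstraction, and \<open>z\<close> serves as
  the fresh name that opens it.\<close>

lemma hnf_App_Var:
  assumes "hnf (App M (Var z)) xs y Ns" "z \<notin> fvL M"
  shows "\<exists>xs' Ns'. hnf M xs' y Ns' \<and> set Ns' \<subseteq> set Ns"
proof -
  have abs: "\<exists>xs' Ns'. hnf M xs' y Ns' \<and> set Ns' \<subseteq> set Ns"
    if "whr\<^sup>*\<^sup>* M (Lam P)" "hnf (openL 0 (Var z) P) ys y Ns" for P ys
  proof -
    have "z \<notin> fvL P" using whrs_fvL[OF that(1)] assms(2) by auto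
    then show ?thesis using hnf_lam[OF that(1)] that(2) by blast
  qed
  from assms(1) show ?thesis
  proof cases
    case hnf_neutral
    from whrs_App_cases[OF hnf_neutral(2)] show ?thesis
    proof (elim disjE exE conjE)
      fix M' assume M': "whr\<^sup>*\<^sup>* M M'" "apps (Var y) Ns = App M' (Var z)"
      \<comment> \<open>The last argument is \<open>z\<close>; dropping it leaves a spine for
        \<open>M\<close>, hence only an inclusion of argument sets.\<close>
      then obtain Ns' N where "Ns = Ns' @ [N]"
        by (cases Ns rule: rev_cases) auto
      with M' show ?thesis by (auto simp: apps_snoc intro!: exI hnf.hnf_neutral)
    next
      fix P assume "whr\<^sup>*\<^sup>* M (Lam P)" "whr\<^sup>*\<^sup>* (openL 0 (Var z) P) (apps (Var y) Ns)"
      then show ?thesis by (intro abs) (auto intro: hnf.hnf_neutral)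
    qed
  next
    case (hnf_lam Q x xs')
    from whrs_App_cases[OF hnf_lam(2)] show ?thesis
    proof (elim disjE exE conjE)
      fix P assume "whr\<^sup>*\<^sup>* M (Lam P)" "whr\<^sup>*\<^sup>* (openL 0 (Var z) P) (Lam Q)"
      then show ?thesis using hnf_lam by (intro abs) (auto intro: hnf.hnf_lam)
    qed simp
  qed
qed

section \<open>Finite approximations of maximality\<close>

fun max_upto :: "nat \<Rightarrow> lterm \<Rightarrow> bool" where
  "max_upto 0 M = True"
| "max_upto (Suc k) M = (\<exists>xs y Ns. hnf M xs y Ns \<and> (\<forall>N\<in>set Ns. lc N \<and> max_upto k N))"

lemma max_upto_Suc_imp: "max_upto (Suc k) M \<Longrightarrow> max_upto k M"
proof (induction k arbitrary: M)
  case (Suc k)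
  then show ?case by (metis max_upto.simps(2))
qed simp

lemma max_upto_antimono: "k \<le> l \<Longrightarrow> max_upto l M \<Longrightarrow> max_upto k M"
  by (induction l) (auto simp: le_Suc_eq dest: max_upto_Suc_imp simp del: max_upto.simps)

lemma max_upto_ren: "max_upto k M \<Longrightarrow> bij f \<Longrightarrow> max_upto k (ren f M)"
proof (induction k arbitrary: M)
  case (Suc k)
  then obtain xs y Ns where h: "hnf M xs y Ns" "\<forall>N\<in>set Ns. lc N \<and> max_upto k N" by auto
  have "hnf (ren f M) (map f xs) (f y) (map (ren f) Ns)"
    by (rule hnf_ren[OF h(1) Suc.prems(2)])
  moreover have "\<forall>N\<in>set (map (ren f) Ns). lc N \<and> max_upto k N"
    using h(2) Suc by auto
  ultimately show ?case unfolding max_upto.simps by blast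
qed simp

lemma max_upto_App_Var:
  "max_upto (Suc k) (App M (Var z)) \<Longrightarrow> z \<notin> fvL M \<Longrightarrow> max_upto (Suc k) M"
proof -
  assume "max_upto (Suc k) (App M (Var z))" and z: "z \<notin> fvL M"
  then obtain xs y Ns where h: "hnf (App M (Var z)) xs y Ns" "\<forall>N\<in>set Ns. lc N \<and> max_upto k N"
    by auto
  then obtain xs' Ns' where "hnf M xs' y Ns'" "set Ns' \<subseteq> set Ns"
    using hnf_App_Var[OF h(1) z] by blast
  then show ?thesis unfolding max_upto.simps using h(2) by blast
qed

text \<open>Coinduction with local closure and goodness up to every depth as invariant. One head
  normal form has to serve all depths, which uniqueness up to renaming allows.\<close>

lemma maximal_if_max_upto:
  assumes "lc M" "\<forall>k. max_upto k M"
  shows "maximal M"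
  using conjI[OF assms]
proof (coinduction arbitrary: M)
  case (maximal M)
  then have M: "lc M" "\<And>k. max_upto k M" by auto
  obtain xs y Ns where h: "hnf M xs y Ns" and lcs: "\<forall>N\<in>set Ns. lc N"
    using M(2)[of "Suc 0"] by auto
  have "max_upto k N" if "N \<in> set Ns" for k N
  proof -
    \<comment> \<open>The witness for depth \<open>Suc k\<close> may use other names; a bijective
      renaming carries its arguments to the fixed \<open>Ns\<close>.\<close>
    obtain xs' y' Ns' where h': "hnf M xs' y' Ns'" "\<forall>N\<in>set Ns'. max_upto k N"
      using M(2)[of "Suc k"] by auto
    obtain f where "bij f" "Ns = map (ren f) Ns'"
      using hnf_unique[OF h'(1) h] by blast
    then show ?thesis using h'(2) that by (auto intro: max_upto_ren)
  qed
  then have "\<exists>xs y Ns. beta\<^sup>*\<^sup>* M (lams xs (apps (Var y) Ns))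
      \<and> (\<forall>N\<in>set Ns. lc N \<and> (lc N \<and> (\<forall>k. max_upto k N) \<or> maximal N))"
    using hnf_imp_betas[OF h M(1)] lcs by blast
  then show ?case by blast
qed

section \<open>Soundness of typing\<close>

definition expansive :: "'w family \<Rightarrow> bool" where
  "expansive S \<longleftrightarrow> (\<forall>p M M'. whr M M' \<longrightarrow> M' \<in> S p \<longrightarrow> M \<in> S p)"

text \<open>A head step of \<open>M\<close> is also a head step of \<open>App M N\<close>. For
  recursive types, induction on worlds shows that the truncations inherit the closure.\<close>

lemma sem_expansive: "\<forall>a. expansive (e a) \<Longrightarrow> expansive (sem A e)"
proof (induction A arbitrary: e)
  case (Arr A B)
  then have "expansive (sem B e)" by simp
  then show ?case unfolding expansive_def using whr_app by fastforce
next
  case (Later A)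
  then have "expansive (sem A e)" by simp
  then show ?case unfolding expansive_def by auto
next
  case (Mu A)
  define S where "S = guarded_fix (\<lambda>S. sem A (push S e))"
  have "\<forall>M M'. whr M M' \<longrightarrow> M' \<in> S p \<longrightarrow> M \<in> S p" for p
  proof (induction p rule: less_induct)
    case (less p)
    then have "expansive (below p S)"
      by (auto simp: expansive_def below_def)
    then have "\<forall>a. expansive (push (below p S) e a)"
      using Mu.prems by (auto simp: push_def split: tatom.splits nat.splits)
    then have "expansive (sem A (push (below p S) e))"
      by (rule Mu.IH)
    moreover have "S p = sem A (push (below p S) e) p"
      unfolding S_def by (rule guarded_fix_eq)
    ultimately show ?case unfolding expansive_def by blast
  qed
  then show ?case by (simp add: expansive_def S_def)
qed auto

lemma lc_at_closeL: "lc_at k M \<Longrightarrow> lc_at (Suc k) (closeL k x M)"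
  by (induction M arbitrary: k) auto

lemma lc_at_substL: "lc_at k M \<Longrightarrow> \<forall>x. lc (\<sigma> x) \<Longrightarrow> lc_at k (substL \<sigma> M)"
  by (induction M arbitrary: k) (auto intro: lc_at_mono)

lemma openL_lc: "lc_at k M \<Longrightarrow> openL k N M = M"
  by (induction M arbitrary: k) auto

lemma openL_substL_closeL:
  "lc_at k M \<Longrightarrow> \<forall>x. lc (\<sigma> x) \<Longrightarrow> openL k N (substL \<sigma> (closeL k x M)) = substL (\<sigma>(x := N)) M"
proof (induction M arbitrary: k)
  case (Var y)
  have "lc_at k (\<sigma> y)" using Var lc_at_mono by blast
  then show ?case by (simp add: openL_lc)
qed auto

lemma substL_Var [simp]: "substL Var M = M"
  by (induction M) auto

lemma typing_ok: "typing \<Gamma> M A \<Longrightarrow> ctx_ok \<Gamma> \<and> lc M \<and> wfty A"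
proof (induction rule: typing.induct)
  case (t_var \<Gamma> x A)
  then show ?case by (auto simp: ctx_ok_def intro: ranI)
next
  case (t_shift \<Gamma> M A)
  have "dom (later_ctx \<Gamma>) = dom \<Gamma>" by (auto simp: later_ctx_def)
  moreover have "Later B \<in> ran (later_ctx \<Gamma>)" if "B \<in> ran \<Gamma>" for B
    using that by (fastforce simp: ran_def later_ctx_def)
  ultimately show ?case
    using t_shift.IH by (auto simp: ctx_ok_def elim: wfty_LaterE)
next
  case (t_top \<Gamma> M)
  then show ?case by (simp add: wfty_Top)
next
  case (t_sub \<Gamma> M A B)
  then show ?case using sub_wfty by (auto simp: subtype_def)
next
  case (t_abs \<Gamma> x A M B)
  have IH: "ctx_ok (\<Gamma>(x \<mapsto> A))" "lc M" "wfty B" using t_abs.IH by blast+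
  have "ran \<Gamma> \<subseteq> ran (\<Gamma>(x \<mapsto> A))"
    using t_abs.hyps(2) by (force simp: ran_def)
  moreover have "A \<in> ran (\<Gamma>(x \<mapsto> A))" by (rule ranI[of _ x]) simp
  ultimately show ?case
    using IH by (auto simp: ctx_ok_def intro: wfty.wf_arr lc_at_closeL)
next
  case (t_app \<Gamma>1 M A B \<Gamma>2 N)
  then have "\<forall>C\<in>ran (\<Gamma>1 ++ \<Gamma>2). wfty C"
    by (auto simp: ctx_ok_def ran_def)
  then show ?case using t_app by (auto simp: ctx_ok_def elim: wfty_ArrE)
qed

lemma typing_sound:
  fixes e :: "tatom \<Rightarrow> 'w::{wellorder, no_top} family"
  assumes her: "\<forall>a. hereditary (e a)" and exp: "\<forall>a. expansive (e a)"
  shows "typing \<Gamma> M A \<Longrightarrow> \<forall>x. lc (\<sigma> x) \<Longrightarrow> \<forall>x B. \<Gamma> x = Some B \<longrightarrow> \<sigma> x \<in> sem B e p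
    \<Longrightarrow> substL \<sigma> M \<in> sem A e p"
proof (induction arbitrary: \<sigma> p rule: typing.induct)
  case (t_var \<Gamma> x A)
  then show ?case by simp
next
  case (t_shift \<Gamma> M A)
  have ok: "ctx_ok (later_ctx \<Gamma>)" "wfty A"
    using typing_ok[OF t_shift.hyps] by (auto elim: wfty_LaterE)
  \<comment> \<open>At the successor world the bullets of the context and of the conclusion
    cancel.\<close>
  have "\<sigma> x \<in> sem B e (next_world p)" if B: "later_ctx \<Gamma> x = Some B" for x B
  proof -
    obtain C where C: "\<Gamma> x = Some C" "B = Later C"
      using B by (auto simp: later_ctx_def)
    have "wfty C" using ok B C by (auto simp: ctx_ok_def elim: wfty_LaterE intro: ranI)
    then show ?thesis
      using t_shift.prems(2) C sem_Later_next[OF sem_hereditary[OF _ her]] by blast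
  qed
  then have "substL \<sigma> M \<in> sem (Later A) e (next_world p)"
    using t_shift by blast
  then show ?case using sem_Later_next[OF sem_hereditary[OF ok(2) her]] by blast
next
  case (t_top \<Gamma> M)
  then show ?case by (simp add: sem_Top)
next
  case (t_sub \<Gamma> M A B)
  then show ?case using sub_sound[of "{}" A B e p] her by (auto simp: subtype_def)
next
  case (t_abs \<Gamma> x A M B)
  have ok: "ctx_ok (\<Gamma>(x \<mapsto> A))" "lc M" using typing_ok[OF t_abs.hyps(1)] by auto
  have "App (substL \<sigma> (Lam (closeL 0 x M))) N \<in> sem B e q"
    if "q \<le> p" "N \<in> sem A e q" "lc N" for q N
  proof -
    have "(\<sigma>(x := N)) y \<in> sem C e q" if C: "(\<Gamma>(x \<mapsto> A)) y = Some C" for y C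
    proof (cases "y = x")
      case True
      then show ?thesis using C \<open>N \<in> sem A e q\<close> by simp
    next
      case False
      have "wfty C" using ok(1) ranI[of "\<Gamma>(x \<mapsto> A)" y, OF C] by (simp add: ctx_ok_def)
      then have "sem C e p \<subseteq> sem C e q"
        using sem_hereditary[OF _ her] \<open>q \<le> p\<close> by (auto simp: hereditary_def)
      then show ?thesis using t_abs.prems(2) C False by auto
    qed
    then have "substL (\<sigma>(x := N)) M \<in> sem B e q"
      using t_abs.prems(1) \<open>lc N\<close> by (intro t_abs.IH) simp_all
    \<comment> \<open>This is the contractum of the applied abstraction; closure under head
      expansion leads back to the redex.\<close>
    then have "openL 0 N (substL \<sigma> (closeL 0 x M)) \<in> sem B e q"
      using ok(2) t_abs.prems(1) by (simp add: openL_substL_closeL)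
    then show ?thesis
      using sem_expansive[OF exp] whr_beta unfolding expansive_def substL.simps by blast
  qed
  then show ?case by simp
next
  case (t_app \<Gamma>1 M A B \<Gamma>2 N)
  have "(\<Gamma>1 ++ \<Gamma>2) x = Some C" if "\<Gamma>1 x = Some C" for x C
  proof (cases "\<Gamma>2 x")
    case (Some D)
    then have "\<Gamma>1 x = \<Gamma>2 x"
      using t_app.hyps(3) that unfolding compatible_def by blast
    then show ?thesis using Some that by (simp add: map_add_def)
  qed (use that in \<open>simp add: map_add_def\<close>)
  then have "substL \<sigma> M \<in> sem (Arr A B) e p"
    using t_app.prems by (intro t_app.IH(1)) blast+
  moreover have "substL \<sigma> N \<in> sem A e p"
    using t_app.prems by (intro t_app.IH(2)) (blast intro: map_add_find_right)+
  moreover have "lc (substL \<sigma> N)"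
    using typing_ok[OF t_app.hyps(2)] t_app.prems(1) by (simp add: lc_at_substL)
  ultimately show ?case by auto
qed

section \<open>Positively and negatively finite types\<close>

lemma etv_top_variant: "top_variant A \<Longrightarrow> etv A = ({}, {})"
  by (cases A) auto

lemma etv_subset_fvT: "AF x \<in> fst (etv A) \<union> snd (etv A) \<Longrightarrow> x \<in> fvT A"
  by (induction A) (auto simp: unb_def split: if_splits)

definition ren_atom :: "nat \<Rightarrow> nat \<Rightarrow> tatom \<Rightarrow> tatom" where
  "ren_atom X Y a = (if a = AF X then AF Y else a)"

text \<open>A variable in place of a variable cannot create a bound tail, so here the status is kept
  in both directions.\<close>

lemma tvar_rename: "tvar ctx (substT X (TFVar Y) A) = tvar ctx A"
  by (induction A arbitrary: ctx) auto

lemma AB_in_ren_atom: "AB k \<in> ren_atom X Y ` S \<longleftrightarrow> AB k \<in> S"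
  by (auto simp: ren_atom_def image_iff split: if_splits)

lemma unb_ren_atom: "unb (ren_atom X Y ` S) = ren_atom X Y ` unb S"
proof (rule set_eqI)
  fix a
  show "a \<in> unb (ren_atom X Y ` S) \<longleftrightarrow> a \<in> ren_atom X Y ` unb S"
  proof (cases a)
    case (AF x)
    then show ?thesis by (force simp: unb_def ren_atom_def)
  next
    case (AB k)
    have "AB k \<in> unb T \<longleftrightarrow> AB (Suc k) \<in> T" for T by (auto simp: unb_def)
    then show ?thesis by (simp add: AB AB_in_ren_atom)
  qed
qed

lemma etv_rename:
  "etv (substT X (TFVar Y) A) = map_prod ((`) (ren_atom X Y)) ((`) (ren_atom X Y)) (etv A)"
proof (induction A)
  case (Mu A)
  have "top_variant (Mu (substT X (TFVar Y) A)) = top_variant (Mu A)"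
    by (simp add: top_variant_def tvar_rename)
  then show ?case
    using Mu by (simp add: AB_in_ren_atom unb_ren_atom image_Un[symmetric])
next
  case (Arr A B)
  have "top_variant (Arr (substT X (TFVar Y) A) (substT X (TFVar Y) B)) = top_variant (Arr A B)"
    by (simp add: top_variant_def tvar_rename)
  then show ?case
    using Arr by (simp add: image_Un)
next
  case (Later A)
  have "top_variant (Later (substT X (TFVar Y) A)) = top_variant (Later A)"
    by (simp add: top_variant_def tvar_rename)
  then show ?case using Later by simp
qed (auto simp: top_variant_def ren_atom_def)

lemma ren_atom_fresh: "AF Y \<notin> S \<Longrightarrow> AF Y \<in> ren_atom X Y ` S \<longleftrightarrow> AF X \<in> S"
  by (auto simp: ren_atom_def image_iff split: if_splits)

lemma substT_fresh: "X \<notin> fvT A \<Longrightarrow> substT X C A = A"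
  by (induction A) auto

lemma substT_rename: "Y \<notin> fvT A \<Longrightarrow> substT Y C (substT X (TFVar Y) A) = substT X C A"
  by (induction A) auto

text \<open>The polarity as a Boolean, \<open>True\<close> for positive, so that passing to the left
  of an arrow is negation.\<close>

definition ETV :: "bool \<Rightarrow> ty \<Rightarrow> nat set" where
  "ETV s A = (if s then ETVp A else ETVn A)"

definition fin :: "bool \<Rightarrow> ty \<Rightarrow> bool" where
  "fin s A \<longleftrightarrow> (\<forall>B C X. wfty B \<and> wfty C \<and> ty_cong A (substT X C B)
     \<and> X \<in> ETV s B \<and> X \<notin> ETV (\<not> s) B \<longrightarrow> \<not> top_variant C)"

lemma pos_finite_eq_fin: "pos_finite A = fin True A"
  and neg_finite_eq_fin: "neg_finite A = fin False A"
  by (auto simp: pos_finite_def neg_finite_def fin_def ETV_def)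

lemma ETV_subset_fvT: "ETV s A \<subseteq> fvT A"
  using etv_subset_fvT by (auto simp: ETV_def ETVp_def ETVn_def)

lemma ETV_top_variant: "top_variant A \<Longrightarrow> ETV s A = {}"
  by (simp add: ETV_def ETVp_def ETVn_def etv_top_variant)

lemma ETV_Later: "\<not> top_variant A \<Longrightarrow> ETV s (Later A) = ETV s A"
  by (simp add: ETV_def ETVp_def ETVn_def top_variant_def)

lemma ETV_Arr: "\<not> top_variant B \<Longrightarrow> ETV s (Arr A B) = ETV (\<not> s) A \<union> ETV s B"
  by (auto simp: ETV_def ETVp_def ETVn_def top_variant_def)

lemma ETV_rename: "Y \<notin> fvT A \<Longrightarrow> Y \<in> ETV s (substT X (TFVar Y) A) \<longleftrightarrow> X \<in> ETV s A"
  using etv_subset_fvT[of Y A]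
    ren_atom_fresh[of Y "fst (etv A)" X] ren_atom_fresh[of Y "snd (etv A)" X]
  by (simp add: ETV_def ETVp_def ETVn_def etv_rename) blast

text \<open>The variable marking the place of \<open>C\<close> can be renamed, so it may be assumed
  to avoid any finite set.\<close>

lemma fin_freshI:
  assumes "finite F"
    and "\<And>B C X. X \<notin> F \<Longrightarrow> wfty B \<Longrightarrow> wfty C \<Longrightarrow> ty_cong A (substT X C B) \<Longrightarrow> X \<in> ETV s B
      \<Longrightarrow> X \<notin> ETV (\<not> s) B \<Longrightarrow> \<not> top_variant C"
  shows "fin s A"
  unfolding fin_def
proof (intro allI impI, elim conjE)
  fix B C X
  assume B: "wfty B" "wfty C" "ty_cong A (substT X C B)" "X \<in> ETV s B" "X \<notin> ETV (\<not> s) B"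
  obtain Y where Y: "Y \<notin> F \<union> fvT B"
    using ex_fresh[of "F \<union> fvT B"] assms(1) by auto
  show "\<not> top_variant C"
  proof (rule assms(2)[of Y "substT X (TFVar Y) B"])
    show "wfty (substT X (TFVar Y) B)" using B(1) by (simp add: wfty_substT wfty.wf_var)
    show "ty_cong A (substT Y C (substT X (TFVar Y) B))" using B(3) Y by (simp add: substT_rename)
  qed (use B Y ETV_rename in auto)
qed

lemma fin_cong: "fin s A \<Longrightarrow> ty_cong A B \<Longrightarrow> fin s B"
  unfolding fin_def by (blast intro: eq_trans)

text \<open>Take the trivial decomposition, where \<open>B\<close> is a bare variable and
  \<open>C\<close> is \<open>A\<close> itself.\<close>

lemma fin_not_top_variant: "wfty A \<Longrightarrow> fin True A \<Longrightarrow> \<not> top_variant A"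
proof -
  assume A: "wfty A" "fin True A"
  have "X \<in> ETV True (TFVar X)" "X \<notin> ETV False (TFVar X)" for X
    by (auto simp: ETV_def ETVp_def ETVn_def top_variant_def)
  moreover have "ty_cong A (substT 0 A (TFVar 0))" using A(1) by (simp add: eq_refl)
  ultimately show ?thesis using A wfty.wf_var[of 0] unfolding fin_def by (metis (full_types))
qed

lemma fin_Later: "fin s (Later A) \<Longrightarrow> fin s A"
proof (rule fin_freshI[of "{}"])
  fix B C X
  assume fin: "fin s (Later A)" and B: "wfty B" "wfty C" "ty_cong A (substT X C B)"
    "X \<in> ETV s B" "X \<notin> ETV (\<not> s) B"
  then have "\<not> top_variant B" using ETV_top_variant by blast
  moreover have "ty_cong (Later A) (substT X C (Later B))" using B(3) by (simp add: eq_later)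
  ultimately show "\<not> top_variant C"
    using fin B wfty.wf_later[OF B(1)] unfolding fin_def by (metis ETV_Later)
qed simp

text \<open>A decomposition of the codomain extends to the arrow; the marking variable is fresh for
  \<open>A\<close>, so the domain adds no occurrence of it.\<close>

lemma fin_Arr_right: "fin s (Arr A B) \<Longrightarrow> wfty A \<Longrightarrow> fin s B"
proof (rule fin_freshI[of "fvT A"])
  fix B' C X
  assume fin: "fin s (Arr A B)" and "wfty A" and X: "X \<notin> fvT A"
    and B: "wfty B'" "wfty C" "ty_cong B (substT X C B')" "X \<in> ETV s B'" "X \<notin> ETV (\<not> s) B'"
  then have "\<not> top_variant B'" using ETV_top_variant by blast
  then have "X \<in> ETV s (Arr A B')" "X \<notin> ETV (\<not> s) (Arr A B')"
    using B X ETV_subset_fvT[of _ A] by (auto simp: ETV_Arr)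
  moreover have "ty_cong (Arr A B) (substT X C (Arr A B'))"
    using B(3) X \<open>wfty A\<close> by (simp add: substT_fresh eq_arr eq_refl)
  ultimately show "\<not> top_variant C"
    using fin B(2) wfty.wf_arr[OF \<open>wfty A\<close> B(1)] unfolding fin_def by blast
qed simp

text \<open>Polarity flips to the left of an arrow. A top-variant codomain would erase all effective
  variables of the arrow.\<close>

lemma fin_Arr_left: "fin s (Arr A B) \<Longrightarrow> wfty B \<Longrightarrow> \<not> top_variant B \<Longrightarrow> fin (\<not> s) A"
proof (rule fin_freshI[of "fvT B"])
  fix A' C X
  assume fin: "fin s (Arr A B)" and "wfty B" "\<not> top_variant B" and X: "X \<notin> fvT B"
    and A: "wfty A'" "wfty C" "ty_cong A (substT X C A')" "X \<in> ETV (\<not> s) A'" "X \<notin> ETV (\<not> \<not> s) A'"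
  have "X \<in> ETV s (Arr A' B)" "X \<notin> ETV (\<not> s) (Arr A' B)"
    using A X ETV_subset_fvT[of _ B] \<open>\<not> top_variant B\<close> by (auto simp: ETV_Arr)
  moreover have "ty_cong (Arr A B) (substT X C (Arr A' B))"
    using A(3) X \<open>wfty B\<close> by (simp add: substT_fresh eq_arr eq_refl)
  ultimately show "\<not> top_variant C"
    using fin A(2) wfty.wf_arr[OF A(1) \<open>wfty B\<close>] unfolding fin_def by blast
qed simp

section \<open>Maximality\<close>

text \<open>Successor worlds are needed in \<omega> squared; raising the second coordinate gives a
  larger world.\<close>

instance prod :: (order, no_top) no_top
proof
  fix p :: "'a \<times> 'b"
  obtain b where "snd p < b" using gt_ex by blast
  then have "p < (fst p, b)" by (cases p) simp
  then show "\<exists>q. p < q" ..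
qed

text \<open>The meaning of every type variable. Arguments are controlled to the depth given by the
  first coordinate only, so finitely many bullets cost no depth.\<close>

definition neutral :: "(nat \<times> nat) family" where
  "neutral p = {M. \<exists>y Ns. whr\<^sup>*\<^sup>* M (apps (Var y) Ns) \<and> (\<forall>N\<in>set Ns. lc N \<and> max_upto (fst p) N)}"

abbreviation tsem :: "ty \<Rightarrow> (nat \<times> nat) family" where
  "tsem A \<equiv> sem A (\<lambda>_. neutral)"

lemma fst_mono: "p \<le> q \<Longrightarrow> fst p \<le> fst q" for p q :: "nat \<times> nat"
  by (cases p; cases q) auto

lemma hereditary_neutral: "hereditary neutral"
proof -
  have "neutral p \<subseteq> neutral q" if "q \<le> p" for p q
    using max_upto_antimono[OF fst_mono[OF that]] unfolding neutral_def by blast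
  then show ?thesis unfolding hereditary_def by blast
qed

lemma expansive_neutral: "expansive neutral"
  unfolding expansive_def neutral_def by (blast intro: converse_rtranclp_into_rtranclp)

lemma tsem_antimono: "wfty A \<Longrightarrow> q \<le> p \<Longrightarrow> tsem A p \<subseteq> tsem A q"
  using sem_hereditary[of A "\<lambda>_. neutral"] hereditary_neutral unfolding hereditary_def by blast

text \<open>Induction along the tail with a growing spine: arrows add arguments until the tail
  variable is reached, which denotes \<open>neutral\<close>. The premise \<open>IH\<close> is the
  converse direction, used on the arguments.\<close>

lemma apps_in_tsem:
  assumes IH: "\<And>l A M j. l \<le> k \<Longrightarrow> wfty A \<Longrightarrow> fin True A \<Longrightarrow> M \<in> tsem A (l, j) \<Longrightarrow> max_upto l M"
    and "wfty A" "fin False A" "fst p \<le> k" "\<forall>N\<in>set Ns. lc N \<and> max_upto (fst p) N"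
  shows "apps (Var y) Ns \<in> tsem A p"
proof (cases "top_variant A")
  case True
  then show ?thesis by (simp add: sem_top_variant)
next
  case False
  then have "tail_free A" using assms(2) top_variant_iff by blast
  from this assms(2) assms(3-) show ?thesis
  proof (induction arbitrary: p Ns rule: tail_free_induct)
    case (Var X)
    then show ?case by (auto simp: neutral_def)
  next
    case (Arr A B)
    have "fin (\<not> False) A"
      using Arr.prems Arr.hyps top_variant_iff by (intro fin_Arr_left[of False A B]) auto
    moreover have "fin False B" using fin_Arr_right Arr by blast
    moreover have "App (apps (Var y) Ns) P \<in> tsem B q"
      if "q \<le> p" "P \<in> tsem A q" "lc P" "fin True A" "fin False B" for q P
    proof -
      have q: "fst q \<le> fst p" using that(1) by (rule fst_mono)
      \<comment> \<open>The domain is positively finite, so its inhabitant \<open>P\<close> is good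
        enough to join the spine.\<close>
      have "max_upto (fst q) P"
        using IH[of "fst q" A P "snd q"] that q Arr.prems Arr.hyps by simp
      then have "\<forall>N\<in>set (Ns @ [P]). lc N \<and> max_upto (fst q) N"
        using Arr.prems that q max_upto_antimono by auto
      then have "apps (Var y) (Ns @ [P]) \<in> tsem B q"
        using Arr.IH that q Arr.prems by simp
      then show ?thesis by (simp add: apps_snoc)
    qed
    ultimately show ?case by simp
  next
    case (Later A)
    have "apps (Var y) Ns \<in> tsem A q" if "q < p" for q
    proof -
      have q: "fst q \<le> fst p" using that by (simp add: fst_mono)
      then show ?thesis
        using Later.prems fin_Later max_upto_antimono[OF q] by (intro Later.IH) auto
    qed
    then show ?case by (simp del: split_paired_All)
  next
    case (Mu A)
    then show ?case
      using fin_cong[OF _ eq_unfold] sem_unfold by metis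
  qed
qed

text \<open>Membership for all \<open>j\<close> survives bullets, since each one only shifts
  \<open>j\<close>. At the tail variable the arguments are good to depth \<open>k\<close>, so
  \<open>M\<close> is good to depth \<open>Suc k\<close>.\<close>

lemma max_upto_Suc_if_tsem:
  assumes neut: "\<And>A j y. wfty A \<Longrightarrow> fin False A \<Longrightarrow> Var y \<in> tsem A (k, j)"
    and "wfty A" "fin True A" "\<forall>j. M \<in> tsem A (k, j)"
  shows "max_upto (Suc k) M"
proof -
  have "tail_free A" using assms(2,3) top_variant_iff fin_not_top_variant by blast
  from this assms(2) assms(3-) show ?thesis
  proof (induction arbitrary: M rule: tail_free_induct)
    case (Var X)
    then show ?case by (auto simp: neutral_def intro: hnf_neutral)
  next
    case (Arr A B)
    have A: "fin False A"
      using fin_Arr_left[OF Arr.prems(1)] Arr.hyps top_variant_iff by simp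
    have B: "fin True B" using fin_Arr_right Arr by blast
    \<comment> \<open>A fresh variable inhabits the negatively finite domain, and a head normal form
      of \<open>App M (Var z)\<close> yields one of \<open>M\<close>.\<close>
    obtain z where z: "z \<notin> fvL M" using ex_fresh[of "fvL M"] by auto
    have "App M (Var z) \<in> tsem B (k, j)" for j
    proof -
      have "M \<in> tsem (Arr A B) (k, j)" using Arr.prems(2) by blast
      then have "\<forall>N\<in>tsem A (k, j). lc N \<longrightarrow> App M N \<in> tsem B (k, j)"
        unfolding sem.simps by blast
      then show ?thesis using neut[OF Arr.hyps(2) A] by simp
    qed
    then have "max_upto (Suc k) (App M (Var z))" using Arr.IH[OF B] by blast
    then show ?case using z by (rule max_upto_App_Var)
  next
    case (Later A)
    have "M \<in> tsem A (k, j)" for j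
    proof -
      have "M \<in> tsem (Later A) (k, Suc j)" using Later.prems(2) by blast
      moreover have "(k, j) < (k, Suc j)" by simp
      ultimately show ?thesis unfolding sem.simps by blast
    qed
    then show ?case using Later fin_Later by blast
  next
    case (Mu A)
    then show ?case
      using fin_cong[OF _ eq_unfold] sem_unfold by metis
  qed
qed

lemma max_upto_if_tsem:
  "wfty A \<Longrightarrow> fin True A \<Longrightarrow> M \<in> tsem A (k, j) \<Longrightarrow> max_upto k M"
proof (induction k arbitrary: A M j rule: less_induct)
  case (less k)
  show ?case
  proof (cases k)
    case (Suc l)
    show ?thesis unfolding Suc
    proof (rule max_upto_Suc_if_tsem)
      fix A j y assume A: "wfty A" "fin False A"
      have "apps (Var y) [] \<in> tsem A (l, j)"
        by (rule apps_in_tsem[of l]) (use less.IH Suc A in auto)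
      then show "Var y \<in> tsem A (l, j)" by simp
    next
      \<comment> \<open>Lexicographically, one world of level \<open>Suc l\<close> lies above all
        worlds of level \<open>l\<close>; this limit step uncovers one layer of the tree.\<close>
      have "(l, i) \<le> (k, j)" for i using Suc by simp
      then show "\<forall>i. M \<in> tsem A (l, i)" using less.prems tsem_antimono by blast
    qed (use less.prems in auto)
  qed simp
qed

theorem theorem8:
  assumes "typing \<Gamma> M A"
    and "pos_finite A"
    and "\<forall>x \<in> dom \<Gamma>. neg_finite (the (\<Gamma> x))"
  shows "maximal M"
proof (rule maximal_if_max_upto)
  have ok: "ctx_ok \<Gamma>" "wfty A" and lc: "lc M" using typing_ok[OF assms(1)] by auto
  show "lc M" by fact
  show "\<forall>k. max_upto k M"
  proof
    fix k
    have "Var x \<in> tsem B (k, 0)" if B: "\<Gamma> x = Some B" for x B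
    proof -
      have "wfty B" using ok(1) B by (auto simp: ctx_ok_def intro: ranI)
      moreover have "fin False B" using assms(3) B by (auto simp: neg_finite_eq_fin dom_def)
      ultimately have "apps (Var x) [] \<in> tsem B (k, 0)"
        by (intro apps_in_tsem[of k]) (auto intro: max_upto_if_tsem)
      then show ?thesis by simp
    qed
    \<comment> \<open>Each variable realizes itself as a spine without arguments, so the identity
      substitution is admissible.\<close>
    then have "substL Var M \<in> tsem A (k, 0)"
      using hereditary_neutral expansive_neutral by (intro typing_sound[OF _ _ assms(1)]) auto
    then show "max_upto k M"
      using max_upto_if_tsem ok(2) assms(2) by (simp add: pos_finite_eq_fin)
  qed
qed

end
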